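(* Let $\mathbb{F}$ be a field with $|\mathbb{F}|\geq 4$, and let $C\in\mathbb{R}^{5\times n}$ be a matrix whose tropical rank satisfies $\mathrm{trop}(C)\leq 3$. Then the Kapranov rank of $C$ with respect to the ground field $\mathbb{F}$ satisfies $\mathrm{K}_{\mathbb{F}}(C)\leq 3$.
   Context: For a field $\mathbb{F}$, let $\mathbf{H}_{\mathbb{F}}$ denote the field of formal sums $a(t)=\sum_{e\in\mathbb{R}}a_e t^e$ with coefficients $a_e\in\mathbb{F}$ whose support $E(a)=\{e\in\mathbb{R}: a_e\neq 0\}$ is a well-ordered subset of $\mathbb{R}$ (usual addition and multiplication of generalized power series, i.e. Hahn series with value group $\mathbb{R}$). Write $\mathbf{H}_{\mathbb{F}}^*$ for its set of nonzero elements. For $a\in\mathbf{H}_{\mathbb{F}}^*$, the degree is $\deg a=\min E(a)$. For a matrix $A\in(\mathbf{H}_{\mathbb{F}}^* )^{m\times n}$, $\deg A\in\mathbb{R}^{m\times n}$ is obtained by applying $\deg$ entrywise. The Kapranov rank of $B\in\mathbb{R}^{m\times n}$ with respect to the ground field $\mathbb{F}$ is $$\mathrm{K}_{\mathbb{F}}(B)=\min\{\mathrm{rank}(A) : A\in(\mathbf{H}_{\mathbb{F}}^* )^{m\times n},\ \deg A=B\},$$ where $\mathrm{rank}$ is the usual rank of matrices over the field $\mathbf{H}_{\mathbb{F}}$. A square matrix $B\in\mathbb{R}^{r\times r}$ is tropically non-singular if the minimum $\min_{\sigma\in S_r}\{b_{1,\sigma(1)}+\cdots+b_{r,\sigma(r)}\}$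 is attained by exactly one permutation $\sigma$; otherwise (the minimum is attained at least twice) it is tropically singular. The tropical rank $\mathrm{trop}(M)$ of $M\in\mathbb{R}^{p\times q}$ is the largest $r$ such that $M$ contains a tropically non-singular $r\times r$ submatrix. *)

theory Defs
  imports "Jordan_Normal_Form.DL_Rank_Submatrix"
begin

section \<open>Well-ordered sets of reals\<close>

text \<open>As \<^typ>\<open>real\<close> is linearly ordered, \<^prop>\<open>wfp_on S ((<) :: real \<Rightarrow> real \<Rightarrow> bool)\<close>
  says that \<^term>\<open>S\<close> is well-ordered by the usual order.\<close>

lemma wo_real_iff:
  fixes S :: "real set"
  shows "wfp_on S (<) \<longleftrightarrow> (\<forall>T\<subseteq>S. T \<noteq> {} \<longrightarrow> (\<exists>m\<in>T. \<forall>x\<in>T. m \<le> x))"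
  unfolding wfp_on_iff_ex_minimal by (meson linorder_not_less)

lemma wo_real_min:
  fixes S :: "real set"
  assumes "wfp_on S (<)" "T \<subseteq> S" "T \<noteq> {}"
  obtains m where "m \<in> T" "\<And>x. x \<in> T \<Longrightarrow> m \<le> x"
  using assms unfolding wo_real_iff by meson

lemma wo_real_Un:
  fixes A B :: "real set"
  assumes "wfp_on A (<)" "wfp_on B (<)"
  shows "wfp_on (A \<union> B) (<)"
  unfolding wo_real_iff
proof (intro allI impI)
  fix T assume T: "T \<subseteq> A \<union> B" "T \<noteq> {}"
  show "\<exists>m\<in>T. \<forall>x\<in>T. m \<le> x"
  proof (cases "T \<inter> A = {} \<or> T \<inter> B = {}")
    case True
    then have "T \<subseteq> A \<or> T \<subseteq> B" using T by blast
    then show ?thesis using assms T unfolding wo_real_iff by blast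
  next
    case False
    obtain m1 where m1: "m1 \<in> T \<inter> A" "\<And>x. x \<in> T \<inter> A \<Longrightarrow> m1 \<le> x"
      by (rule wo_real_min[OF assms(1), of "T \<inter> A"]) (use False in auto)
    obtain m2 where m2: "m2 \<in> T \<inter> B" "\<And>x. x \<in> T \<inter> B \<Longrightarrow> m2 \<le> x"
      by (rule wo_real_min[OF assms(2), of "T \<inter> B"]) (use False in auto)
    have "min m1 m2 \<in> T" using m1(1) m2(1) by (auto simp: min_def)
    moreover have "\<forall>x\<in>T. min m1 m2 \<le> x"
    proof
      fix x assume x: "x \<in> T"
      then have "x \<in> T \<inter> A \<or> x \<in> T \<inter> B" using T(1) by blast
      then show "min m1 m2 \<le> x" using m1(2)[of x] m2(2)[of x] by linarith
    qed
    ultimately show ?thesis by blast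
  qed
qed

lemma wo_real_finite:
  fixes S :: "real set"
  shows "finite S \<Longrightarrow> wfp_on S (<)"
  unfolding wo_real_iff by (meson Min_in Min_le finite_subset)

lemma finite_real_if_min_max:
  fixes F :: "real set"
  assumes min: "\<And>T. T \<subseteq> F \<Longrightarrow> T \<noteq> {} \<Longrightarrow> \<exists>m\<in>T. \<forall>x\<in>T. m \<le> x"
    and max: "\<And>T. T \<subseteq> F \<Longrightarrow> T \<noteq> {} \<Longrightarrow> \<exists>m\<in>T. \<forall>x\<in>T. x \<le> m"
  shows "finite F"
proof (rule ccontr)
  assume inf: "infinite F"
  define S where "S = {x\<in>F. finite {y\<in>F. y \<le> x}}"
  obtain m0 where m0: "m0 \<in> F" "\<forall>x\<in>F. m0 \<le> x" using min[of F] inf by auto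
  have "{y\<in>F. y \<le> m0} = {m0}" using m0 by force
  then have "S \<noteq> {}" using m0 S_def by auto
  then obtain m where m: "m \<in> S" "\<forall>x\<in>S. x \<le> m" using max[of S] S_def by blast
  have "{y\<in>F. y > m} \<noteq> {}"
  proof
    assume "{y\<in>F. y > m} = {}"
    then have "{y\<in>F. y \<le> m} = F" by force
    then show False using m inf S_def by auto
  qed
  then obtain k where k: "k \<in> F" "m < k" "\<And>x. x \<in> F \<Longrightarrow> m < x \<Longrightarrow> k \<le> x"
    using min[of "{y\<in>F. y > m}"] by auto
  have "{y\<in>F. y \<le> k} \<subseteq> insert k {y\<in>F. y \<le> m}" using k(3) by force
  then have "finite {y\<in>F. y \<le> k}" using m(1) S_def finite_subset by auto
  then have "k \<in> S" using k S_def by auto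
  then show False using m k by force
qed

definition sum_pairs :: "real set \<Rightarrow> real set \<Rightarrow> real \<Rightarrow> (real \<times> real) set" where
  "sum_pairs A B e = {(x, y). x \<in> A \<and> y \<in> B \<and> x + y = e}"

lemma finite_sum_pairs:
  assumes A: "wfp_on A (<)" and B: "wfp_on B (<)"
  shows "finite (sum_pairs A B e)"
proof -
  define F where "F = {x\<in>A. e - x \<in> B}"
  have "finite F"
  proof (rule finite_real_if_min_max)
    fix T assume T: "T \<subseteq> F" "T \<noteq> {}"
    show "\<exists>m\<in>T. \<forall>x\<in>T. m \<le> x"
    proof -
      have "T \<subseteq> A" using T F_def by auto
      then show ?thesis using A T(2) unfolding wo_real_iff by blast
    qed
    have "(\<lambda>x. e - x) ` T \<subseteq> B" "(\<lambda>x. e - x) ` T \<noteq> {}" using T unfolding F_def by auto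
    then obtain m where "m \<in> (\<lambda>x. e - x) ` T" "\<And>x. x \<in> (\<lambda>x. e - x) ` T \<Longrightarrow> m \<le> x"
      by (rule wo_real_min[OF B]) (rule that)
    then show "\<exists>m\<in>T. \<forall>x\<in>T. x \<le> m" by fastforce
  qed
  moreover have "sum_pairs A B e \<subseteq> (\<lambda>x. (x, e - x)) ` F"
    unfolding F_def sum_pairs_def by force
  ultimately show ?thesis by (meson finite_imageI finite_subset)
qed

lemma wo_real_mono_subseq:
  fixes s :: "nat \<Rightarrow> real"
  assumes A: "wfp_on A (<)" and s: "\<And>n. s n \<in> A"
  shows "\<exists>g :: nat \<Rightarrow> nat. strict_mono g \<and> mono (s \<circ> g)"
proof -
  obtain f where f: "strict_mono f" "monoseq (\<lambda>n. s (f n))" using seq_monosub by blast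
  show ?thesis
  proof (cases "incseq (\<lambda>n. s (f n))")
    case True
    then show ?thesis using f by (intro exI[of _ f]) (simp add: o_def)
  next
    case False
    then have dec: "decseq (\<lambda>n. s (f n))" using f(2) monoseq_iff by auto
    obtain m where m: "m \<in> range (\<lambda>n. s (f n))" "\<And>x. x \<in> range (\<lambda>n. s (f n)) \<Longrightarrow> m \<le> x"
      by (rule wo_real_min[OF A, of "range (\<lambda>n. s (f n))"]) (use s in auto)
    then obtain N where N: "m = s (f N)" by blast
    have const: "s (f (n + N)) = m" for n
      using m(2)[of "s (f (n + N))"] decseqD[OF dec, of N "n + N"] N by force
    have "strict_mono (\<lambda>n. f (n + N))" using f(1) by (simp add: strict_mono_def)
    moreover have "mono (s \<circ> (\<lambda>n. f (n + N)))" by (simp add: o_def const mono_def)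
    ultimately show ?thesis by blast
  qed
qed

lemma wo_real_sumset:
  fixes A B :: "real set"
  assumes A: "wfp_on A (<)" and B: "wfp_on B (<)"
  shows "wfp_on {x + y | x y. x \<in> A \<and> y \<in> B} (<)"
proof (rule ccontr)
  assume "\<not> ?thesis"
  then obtain T where T: "T \<subseteq> {x + y | x y. x \<in> A \<and> y \<in> B}" "T \<noteq> {}"
      "\<And>m. m \<in> T \<Longrightarrow> \<exists>x\<in>T. x < m"
    unfolding wo_real_iff by (meson linorder_not_less)
  then obtain t0 where "t0 \<in> T" by blast
  have "\<exists>f. \<forall>n::nat. f n \<in> T \<and> f (Suc n) < f n"
  proof (intro dependent_nat_choice[where P = "\<lambda>_ x. x \<in> T" and Q = "\<lambda>_ x y. y < x"])
    show "\<exists>x. x \<in> T" using \<open>t0 \<in> T\<close> by blast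
    show "\<exists>y. y \<in> T \<and> y < x" if "x \<in> T" for x and n :: nat using T(3)[OF that] by blast
  qed
  then obtain f where f: "\<And>n::nat. f n \<in> T" "\<And>n. f (Suc n) < f n" by blast
  have "\<forall>n. \<exists>x y. x \<in> A \<and> y \<in> B \<and> f n = x + y" using f(1) T(1) by blast
  then obtain a b where ab: "\<And>n. a n \<in> A" "\<And>n. b n \<in> B" "\<And>n. f n = a n + b n" by metis
  obtain g :: "nat \<Rightarrow> nat" where g: "strict_mono g" "mono (a \<circ> g)"
    using wo_real_mono_subseq[of A a, OF A ab(1)] by (elim exE conjE) (rule that)
  have dec: "b (g (Suc n)) < b (g n)" for n
  proof -
    have "f (g (Suc n)) < f (g n)"
      using lift_Suc_mono_less[of "\<lambda>n. - f n" "g n" "g (Suc n)"] f(2) strict_monoD[OF g(1), of n "Suc n"]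
      by simp
    moreover have "a (g n) \<le> a (g (Suc n))" using g(2) by (simp add: mono_def)
    ultimately show ?thesis using ab(3) by simp
  qed
  obtain m where m: "m \<in> range (b \<circ> g)" "\<And>x. x \<in> range (b \<circ> g) \<Longrightarrow> m \<le> x"
    by (rule wo_real_min[OF B, of "range (b \<circ> g)"]) (use ab(2) in auto)
  then obtain N where "m = b (g N)" by auto
  then show False using dec[of N] m(2)[of "b (g (Suc N))"] by force
qed


section \<open>Hahn series with value group the reals\<close>

typedef (overloaded) 'a hahn = "{a :: real \<Rightarrow> 'a::zero. wfp_on {e. a e \<noteq> 0} (<)}"
  morphisms hcoeff Abs_hahn
  by (rule exI[of _ "\<lambda>_. 0"]) (simp add: wo_real_finite)

setup_lifting type_definition_hahn

definition hsupp :: "'a::zero hahn \<Rightarrow> real set" where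
  "hsupp a = {e. hcoeff a e \<noteq> 0}"

lemma wo_hsupp: "wfp_on (hsupp a) (<)"
  unfolding hsupp_def by transfer simp

lemma hahn_eqI: "(\<And>e. hcoeff a e = hcoeff b e) \<Longrightarrow> a = b"
  by transfer auto

lift_definition hmonom :: "real \<Rightarrow> 'a::zero \<Rightarrow> 'a hahn" is "\<lambda>d c e. if e = d then c else 0"
  by (auto intro!: wo_real_finite)

text \<open>\<^term>\<open>hdeg a\<close> is the minimum of the support; it is only meaningful for \<^prop>\<open>a \<noteq> 0\<close>.\<close>

definition hdeg :: "'a::zero hahn \<Rightarrow> real" where
  "hdeg a = (LEAST e. e \<in> hsupp a)"

instantiation hahn :: (comm_ring_1) comm_ring_1
begin

lift_definition zero_hahn :: "'a hahn" is "\<lambda>_. 0"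
  by (simp add: wo_real_finite)

definition one_hahn :: "'a hahn" where "one_hahn = hmonom 0 1"

lift_definition plus_hahn :: "'a hahn \<Rightarrow> 'a hahn \<Rightarrow> 'a hahn" is "\<lambda>a b e. a e + b e"
  by (erule (1) wfp_on_subset[OF wo_real_Un]) auto

lift_definition uminus_hahn :: "'a hahn \<Rightarrow> 'a hahn" is "\<lambda>a e. - a e"
  by simp

lift_definition minus_hahn :: "'a hahn \<Rightarrow> 'a hahn \<Rightarrow> 'a hahn" is "\<lambda>a b e. a e - b e"
  by (erule (1) wfp_on_subset[OF wo_real_Un]) auto

text \<open>The index set of the sum is finite because both supports are well-ordered
  (see \<open>finite_sum_pairs\<close>), so the junk value of infinite sums is never used.\<close>

lift_definition times_hahn :: "'a hahn \<Rightarrow> 'a hahn \<Rightarrow> 'a hahn" is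
  "\<lambda>a b e. \<Sum>(x, y) \<in> {(x, y). a x \<noteq> 0 \<and> b y \<noteq> 0 \<and> x + y = e}. a x * b y"
proof -
  fix a b :: "real \<Rightarrow> 'a"
  assume "wfp_on {e. a e \<noteq> 0} (<)" "wfp_on {e. b e \<noteq> 0} (<)"
  note wo_real_sumset[OF this]
  then show "wfp_on {e. (\<Sum>(x, y) \<in> {(x, y). a x \<noteq> 0 \<and> b y \<noteq> 0 \<and> x + y = e}. a x * b y) \<noteq> 0} (<)"
  proof (rule wfp_on_subset, safe)
    fix e
    assume "(\<Sum>(x, y) \<in> {(x, y). a x \<noteq> 0 \<and> b y \<noteq> 0 \<and> x + y = e}. a x * b y) \<noteq> 0"
    then have "{(x, y). a x \<noteq> 0 \<and> b y \<noteq> 0 \<and> x + y = e} \<noteq> {}" by (metis sum.empty)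
    then show "\<exists>x y. e = x + y \<and> x \<in> {e. a e \<noteq> 0} \<and> y \<in> {e. b e \<noteq> 0}" by auto
  qed
qed

lemma hcoeff_times:
  fixes a b :: "'a hahn"
  assumes A: "wfp_on A (<)" "hsupp a \<subseteq> A" and B: "wfp_on B (<)" "hsupp b \<subseteq> B"
  shows "hcoeff (a * b) e = (\<Sum>(x, y)\<in>sum_pairs A B e. hcoeff a x * hcoeff b y)"
proof -
  have "hcoeff (a * b) e = (\<Sum>(x, y)\<in>sum_pairs (hsupp a) (hsupp b) e. hcoeff a x * hcoeff b y)"
    unfolding sum_pairs_def hsupp_def by transfer simp
  also have "\<dots> = (\<Sum>(x, y)\<in>sum_pairs A B e. hcoeff a x * hcoeff b y)"
    by (rule sum.mono_neutral_left[OF finite_sum_pairs[OF A(1) B(1)]])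
      (use A B in \<open>auto simp: sum_pairs_def hsupp_def\<close>)
  finally show ?thesis .
qed

lemma hcoeff_zero [simp]: "hcoeff (0 :: 'a hahn) e = 0"
  by transfer simp

lemma hcoeff_plus [simp]: "hcoeff (a + b :: 'a hahn) e = hcoeff a e + hcoeff b e"
  by transfer simp

lemma hcoeff_uminus [simp]: "hcoeff (- a :: 'a hahn) e = - hcoeff a e"
  by transfer simp

lemma hcoeff_minus [simp]: "hcoeff (a - b :: 'a hahn) e = hcoeff a e - hcoeff b e"
  by transfer simp

lemma hcoeff_hmonom: "hcoeff (hmonom d c :: 'a hahn) e = (if e = d then c else 0)"
  by transfer simp

lemma hcoeff_hmonom_times: "hcoeff (hmonom d c * a :: 'a hahn) e = c * hcoeff a (e - d)"
proof -
  have "hcoeff (hmonom d c * a) e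
      = (\<Sum>(x, y)\<in>sum_pairs {d} (insert (e - d) (hsupp a)) e. hcoeff (hmonom d c) x * hcoeff a y)"
  proof (rule hcoeff_times)
    show "wfp_on (insert (e - d) (hsupp a)) (<)"
      using wo_real_Un[OF wo_real_finite[of "{e - d}"] wo_hsupp[of a]] by simp
  qed (auto simp: hsupp_def hcoeff_hmonom wo_real_finite split: if_splits)
  also have "sum_pairs {d} (insert (e - d) (hsupp a)) e = {(d, e - d)}"
    by (auto simp: sum_pairs_def)
  finally show ?thesis by (simp add: hcoeff_hmonom)
qed

instance
proof
  fix a b c :: "'a hahn"
  show "a + b + c = a + (b + c)" "a + b = b + a" "0 + a = a" "- a + a = 0" "a - b = a + - b"
    by (auto intro!: hahn_eqI)
  show "(0 :: 'a hahn) \<noteq> 1"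
  proof
    assume "(0 :: 'a hahn) = 1"
    then have "hcoeff (0 :: 'a hahn) 0 = hcoeff 1 0" by simp
    then show False by (simp add: one_hahn_def hcoeff_hmonom)
  qed
  show "1 * a = a"
    by (rule hahn_eqI) (simp add: one_hahn_def hcoeff_hmonom_times)
  show "a * b = b * a"
  proof (rule hahn_eqI)
    fix e
    show "hcoeff (a * b) e = hcoeff (b * a) e"
      unfolding hcoeff_times[OF wo_hsupp subset_refl wo_hsupp subset_refl]
      by (rule sum.reindex_bij_witness[of _ prod.swap prod.swap])
        (auto simp: sum_pairs_def mult.commute)
  qed
  show "(a + b) * c = a * c + b * c"
  proof (rule hahn_eqI)
    fix e
    let ?A = "hsupp a \<union> hsupp b"
    have wo: "wfp_on ?A (<)" by (intro wo_real_Un wo_hsupp)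
    have sub: "hsupp (a + b) \<subseteq> ?A" by (auto simp: hsupp_def)
    show "hcoeff ((a + b) * c) e = hcoeff (a * c + b * c) e"
      unfolding hcoeff_plus hcoeff_times[OF wo sub wo_hsupp subset_refl]
        hcoeff_times[OF wo Un_upper1 wo_hsupp subset_refl]
        hcoeff_times[OF wo Un_upper2 wo_hsupp subset_refl]
      by (simp only: case_prod_unfold hcoeff_plus distrib_right sum.distrib)
  qed
  show "a * b * c = a * (b * c)"
  proof (rule hahn_eqI)
    fix e
    let ?S = "\<lambda>A B. {x + y | x y. x \<in> A \<and> y \<in> B}"
    let ?A = "hsupp a" and ?B = "hsupp b" and ?C = "hsupp c"
    have sub: "hsupp (f * g) \<subseteq> ?S (hsupp f) (hsupp g)" for f g :: "'a hahn"
    proof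
      fix e assume "e \<in> hsupp (f * g)"
      then have "sum_pairs (hsupp f) (hsupp g) e \<noteq> {}"
        unfolding hsupp_def[of "f * g"] hcoeff_times[OF wo_hsupp subset_refl wo_hsupp subset_refl]
        by auto
      then show "e \<in> ?S (hsupp f) (hsupp g)" by (auto simp: sum_pairs_def)
    qed
    have wo: "wfp_on (?S (hsupp f) (hsupp g)) (<)" for f g :: "'a hahn"
      by (intro wo_real_sumset wo_hsupp)
    note ct = hcoeff_times[OF wo_hsupp subset_refl wo_hsupp subset_refl]
    have fin: "finite (sum_pairs (hsupp f) (hsupp g) e)" for f g :: "'a hahn" and e
      by (intro finite_sum_pairs wo_hsupp)
    have "hcoeff (a * b * c) e = (\<Sum>p\<in>sum_pairs (?S ?A ?B) ?C e. \<Sum>q\<in>sum_pairs ?A ?B (fst p).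
        hcoeff a (fst q) * hcoeff b (snd q) * hcoeff c (snd p))"
      unfolding hcoeff_times[OF wo sub wo_hsupp subset_refl] unfolding ct
      by (simp add: case_prod_unfold sum_distrib_right)
    also have "\<dots> = (\<Sum>(p, q)\<in>(SIGMA p:sum_pairs (?S ?A ?B) ?C e. sum_pairs ?A ?B (fst p)).
        hcoeff a (fst q) * hcoeff b (snd q) * hcoeff c (snd p))"
      by (rule sum.Sigma) (use fin finite_sum_pairs[OF wo wo_hsupp] in auto)
    also have "\<dots> = (\<Sum>(p, q)\<in>(SIGMA p:sum_pairs ?A (?S ?B ?C) e. sum_pairs ?B ?C (snd p)).
        hcoeff a (fst p) * (hcoeff b (fst q) * hcoeff c (snd q)))"
      by (rule sum.reindex_bij_witness[of _
            "\<lambda>((x, v), (y, z)). ((x + y, z), (x, y))" "\<lambda>((u, z), (x, y)). ((x, y + z), (y, z))"])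
        (auto simp: sum_pairs_def mult.assoc)
    also have "\<dots> = (\<Sum>p\<in>sum_pairs ?A (?S ?B ?C) e. \<Sum>q\<in>sum_pairs ?B ?C (snd p).
        hcoeff a (fst p) * (hcoeff b (fst q) * hcoeff c (snd q)))"
      by (rule sum.Sigma[symmetric]) (use fin finite_sum_pairs[OF wo_hsupp wo] in auto)
    also have "\<dots> = hcoeff (a * (b * c)) e"
      unfolding hcoeff_times[OF wo_hsupp subset_refl wo sub] unfolding ct
      by (simp add: case_prod_unfold sum_distrib_left)
    finally show "hcoeff (a * b * c) e = hcoeff (a * (b * c)) e" .
  qed
qed

end

lemma hcoeff_one: "hcoeff (1 :: 'a::comm_ring_1 hahn) e = (if e = 0 then 1 else 0)"
  by (simp add: one_hahn_def hcoeff_hmonom)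

lemma hcoeff_sum: "hcoeff (\<Sum>i\<in>I. f i :: 'a::comm_ring_1 hahn) e = (\<Sum>i\<in>I. hcoeff (f i) e)"
  by (induction I rule: infinite_finite_induct) auto

lemma hdeg_in_hsupp:
  assumes "a \<noteq> (0 :: 'a::comm_ring_1 hahn)"
  shows "hdeg a \<in> hsupp a" and "\<And>e. e \<in> hsupp a \<Longrightarrow> hdeg a \<le> e"
proof -
  have "hsupp a \<noteq> {}" using assms hahn_eqI[of a 0] by (auto simp: hsupp_def)
  then obtain m where m: "m \<in> hsupp a" "\<And>x. x \<in> hsupp a \<Longrightarrow> m \<le> x"
    by (rule wo_real_min[OF wo_hsupp subset_refl]) (rule that)
  then have "hdeg a = m" unfolding hdeg_def by (intro Least_equality)
  then show "hdeg a \<in> hsupp a" and "\<And>e. e \<in> hsupp a \<Longrightarrow> hdeg a \<le> e" using m by auto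
qed

lemma hdeg_hmonom: "c \<noteq> (0 :: 'a::comm_ring_1) \<Longrightarrow> hdeg (hmonom d c) = d"
  unfolding hdeg_def hsupp_def by (rule Least_equality) (auto simp: hcoeff_hmonom split: if_splits)

lemma hsupp_times_ge:
  fixes a b :: "'a::comm_ring_1 hahn"
  assumes "\<And>x. x \<in> hsupp a \<Longrightarrow> s \<le> x" "\<And>x. x \<in> hsupp b \<Longrightarrow> t \<le> x" "e \<in> hsupp (a * b)"
  shows "s + t \<le> e"
proof -
  have "sum_pairs (hsupp a) (hsupp b) e \<noteq> {}"
    using assms(3) unfolding hsupp_def[of "a * b"]
      hcoeff_times[OF wo_hsupp subset_refl wo_hsupp subset_refl]
    by auto
  then show ?thesis using assms(1,2) unfolding sum_pairs_def by force
qed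

text \<open>The inverse of \<open>1 - f\<close>, for \<open>f\<close> supported on positive exponents, is the geometric series.\<close>

lemma one_minus_hahn_invertible:
  fixes f :: "'a::comm_ring_1 hahn"
  assumes s: "s > 0" and f: "\<And>x. x \<in> hsupp f \<Longrightarrow> s \<le> x"
  shows "\<exists>g. (1 - f) * g = 1"
proof -
  define G where "G n = (\<Sum>k\<le>n. f ^ k)" for n :: nat
  define N where "N x = nat \<lceil>x / s\<rceil>" for x
  have N: "x < real (Suc (N x)) * s" for x
  proof -
    have "x / s < real (Suc (N x))" unfolding N_def by linarith
    then show ?thesis using s by (simp add: field_simps)
  qed
  have pow: "real n * s \<le> x" if "x \<in> hsupp (f ^ n)" for n x
    using that
  proof (induction n arbitrary: x)
    case 0
    then show ?case by (simp add: hsupp_def hcoeff_one split: if_splits)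
  next
    case (Suc n)
    have "s + real n * s \<le> x" by (rule hsupp_times_ge[OF f]) (use Suc in auto)
    then show ?case by (simp add: algebra_simps)
  qed
  then have pow0: "hcoeff (f ^ n) x = 0" if "x < real n * s" for n x
    using that pow[of x n] unfolding hsupp_def by force
  have stab: "hcoeff (G m) x = hcoeff (G n) x" if "n \<le> m" "x < real (Suc n) * s" for n m x
    using that
  proof (induction m rule: dec_induct)
    case base
    then show ?case by simp
  next
    case (step m)
    have "real (Suc n) * s \<le> real (Suc m) * s" using step s by (intro mult_right_mono) auto
    then have "hcoeff (f ^ Suc m) x = 0" using step by (intro pow0) linarith
    then show ?case using step by (simp add: G_def)
  qed
  define g where "g x = hcoeff (G (N x)) x" for x
  have g: "g y = hcoeff (G (N x)) y" if "y \<le> x" for x y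
  proof -
    have "N y \<le> N x" unfolding N_def using that s
      by (intro nat_mono ceiling_mono divide_right_mono) auto
    then show ?thesis unfolding g_def using stab N by metis
  qed
  have "wfp_on {x. g x \<noteq> 0} (<)"
    unfolding wo_real_iff
  proof (intro allI impI)
    fix T assume T: "T \<subseteq> {x. g x \<noteq> 0}" "T \<noteq> {}"
    then obtain t where t: "t \<in> T" by blast
    have "{y\<in>T. y \<le> t} \<subseteq> hsupp (G (N t))" using T g by (auto simp: hsupp_def)
    moreover have "{y\<in>T. y \<le> t} \<noteq> {}" using t by auto
    ultimately obtain m where m: "m \<in> {y\<in>T. y \<le> t}" "\<And>x. x \<in> {y\<in>T. y \<le> t} \<Longrightarrow> m \<le> x"
      by (rule wo_real_min[OF wo_hsupp]) (rule that)
    have "m \<le> x" if "x \<in> T" for x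
      using m(1) m(2)[of x] that by (cases "x \<le> t") auto
    then show "\<exists>m\<in>T. \<forall>x\<in>T. m \<le> x" using m(1) by blast
  qed
  then have g': "hcoeff (Abs_hahn g) = g" by (simp add: Abs_hahn_inverse)
  have "(1 - f) * Abs_hahn g = 1"
  proof (rule hahn_eqI)
    fix x
    let ?B = "hsupp (Abs_hahn g) \<union> hsupp (G (N x))"
    have wo: "wfp_on ?B (<)" by (intro wo_real_Un wo_hsupp)
    have pos: "0 \<le> u" if "u \<in> hsupp (1 - f)" for u
    proof (rule ccontr)
      assume "\<not> 0 \<le> u"
      then have "hcoeff f u = 0" using f[of u] s unfolding hsupp_def by force
      then show False using that \<open>\<not> 0 \<le> u\<close> by (simp add: hsupp_def hcoeff_one)
    qed
    have "hcoeff ((1 - f) * Abs_hahn g) x = hcoeff ((1 - f) * G (N x)) x"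
      unfolding hcoeff_times[OF wo_hsupp subset_refl wo Un_upper1]
        hcoeff_times[OF wo_hsupp subset_refl wo Un_upper2]
    proof (rule sum.cong[OF refl], clarify)
      fix u v assume "(u, v) \<in> sum_pairs (hsupp (1 - f)) ?B x"
      then have "v \<le> x" using pos unfolding sum_pairs_def by force
      then show "hcoeff (1 - f) u * hcoeff (Abs_hahn g) v = hcoeff (1 - f) u * hcoeff (G (N x)) v"
        using g g' by simp
    qed
    also have "(1 - f) * G (N x) = 1 - f ^ Suc (N x)"
      unfolding G_def by (rule sum_gp_basic)
    also have "hcoeff \<dots> x = hcoeff 1 x"
      using pow0[OF N[of x]] by simp
    finally show "hcoeff ((1 - f) * Abs_hahn g) x = hcoeff 1 x" .
  qed
  then show ?thesis by blast
qed

lemma hahn_invertible: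
  fixes a :: "'a::field hahn"
  assumes "a \<noteq> 0"
  shows "\<exists>b. a * b = 1"
proof -
  define d where "d = hdeg a"
  define u where "u = hmonom (- d) (inverse (hcoeff a d))"
  have d: "hcoeff a d \<noteq> 0" "\<And>e. hcoeff a e \<noteq> 0 \<Longrightarrow> d \<le> e"
    using hdeg_in_hsupp[OF assms] by (auto simp: d_def hsupp_def)
  define f where "f = 1 - u * a"
  have cf: "hcoeff f x = (if x = 0 then 1 else 0) - inverse (hcoeff a d) * hcoeff a (x + d)" for x
    by (simp add: f_def hcoeff_one u_def hcoeff_hmonom_times)
  have pos: "0 < x" if "x \<in> hsupp f" for x
  proof -
    have nz: "hcoeff f x \<noteq> 0" using that by (simp add: hsupp_def)
    then have "x \<noteq> 0" using d(1) by (auto simp: cf)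
    moreover have "d \<le> x + d" using nz d(2)[of "x + d"] \<open>x \<noteq> 0\<close> by (auto simp: cf)
    ultimately show ?thesis by simp
  qed
  have "\<exists>s>0. \<forall>x\<in>hsupp f. s \<le> x"
  proof (cases "hsupp f = {}")
    case True
    then show ?thesis by (intro exI[of _ 1]) auto
  next
    case False
    obtain m where "m \<in> hsupp f" "\<And>x. x \<in> hsupp f \<Longrightarrow> m \<le> x"
      by (rule wo_real_min[OF wo_hsupp subset_refl False]) (rule that)
    then show ?thesis using pos by blast
  qed
  then obtain s where "s > 0" "\<And>x. x \<in> hsupp f \<Longrightarrow> s \<le> x" by blast
  then obtain g where "(1 - f) * g = 1" using one_minus_hahn_invertible by blast
  then have "a * (u * g) = 1" by (simp add: f_def ac_simps)
  then show ?thesis by blast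
qed

instantiation hahn :: (field) field
begin

definition inverse_hahn :: "'a hahn \<Rightarrow> 'a hahn" where
  "inverse_hahn a = (if a = 0 then 0 else SOME b. a * b = 1)"

definition divide_hahn :: "'a hahn \<Rightarrow> 'a hahn \<Rightarrow> 'a hahn" where
  "divide_hahn a b = a * inverse b"

instance
proof
  fix a b :: "'a hahn"
  show "inverse a * a = 1" if "a \<noteq> 0"
    using someI_ex[OF hahn_invertible[OF that]] that by (simp add: inverse_hahn_def mult.commute)
  show "a div b = a * inverse b" by (rule divide_hahn_def)
  show "inverse (0 :: 'a hahn) = 0" by (simp add: inverse_hahn_def)
qed

end


section \<open>Kapranov rank and tropical rank\<close>

text \<open>\<^term>\<open>vec_space.rank m A\<close> is the dimension of the column space of \<^term>\<open>A\<close> inside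
  the space of vectors of length \<^term>\<open>m\<close>, which has to be the number of rows of \<^term>\<open>A\<close>.\<close>

definition hahn_lifts :: "real mat \<Rightarrow> 'f::field hahn mat set" where
  "hahn_lifts B = {A \<in> carrier_mat (dim_row B) (dim_col B).
     (\<forall>i<dim_row B. \<forall>j<dim_col B. A $$ (i, j) \<noteq> 0) \<and> map_mat hdeg A = B}"

definition kapranov_rank :: "'f::field itself \<Rightarrow> real mat \<Rightarrow> nat" where
  "kapranov_rank _ B =
     (LEAST r. \<exists>A :: 'f hahn mat. A \<in> hahn_lifts B \<and> vec_space.rank (dim_row B) A = r)"

lemma hahn_lifts_nonempty: "(hahn_lifts B :: 'f::field hahn mat set) \<noteq> {}"
proof -
  have "hmonom d (1 :: 'f) \<noteq> 0" for d
  proof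
    assume "hmonom d (1 :: 'f) = 0"
    then have "hcoeff (hmonom d (1 :: 'f)) d = hcoeff 0 d" by simp
    then show False by (simp add: hcoeff_hmonom)
  qed
  then have "map_mat (\<lambda>d. hmonom d (1 :: 'f)) B \<in> hahn_lifts B"
    by (auto simp: hahn_lifts_def hdeg_hmonom)
  then show ?thesis by blast
qed

lemma kapranov_rank_attained:
  "\<exists>A \<in> (hahn_lifts B :: 'f::field hahn mat set). vec_space.rank (dim_row B) A = kapranov_rank TYPE('f) B"
proof -
  have "\<exists>r. \<exists>A :: 'f hahn mat. A \<in> hahn_lifts B \<and> vec_space.rank (dim_row B) A = r"
    using hahn_lifts_nonempty by blast
  from LeastI_ex[OF this] show ?thesis unfolding kapranov_rank_def by blast
qed

definition trop_weight :: "real mat \<Rightarrow> (nat \<Rightarrow> nat) \<Rightarrow> real" where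
  "trop_weight B \<sigma> = (\<Sum>i<dim_row B. B $$ (i, \<sigma> i))"

definition trop_nonsingular :: "real mat \<Rightarrow> bool" where
  "trop_nonsingular B \<longleftrightarrow> square_mat B \<and>
     (\<exists>!\<sigma>. \<sigma> permutes {..<dim_row B} \<and>
        trop_weight B \<sigma> = (MIN \<tau>\<in>{\<tau>. \<tau> permutes {..<dim_row B}}. trop_weight B \<tau>))"

text \<open>The empty submatrix is tropically non-singular, so the maximum below is over a
  non-empty set of numbers.\<close>

definition trop_rank :: "real mat \<Rightarrow> nat" where
  "trop_rank M = Max {r. \<exists>I J. I \<subseteq> {..<dim_row M} \<and> J \<subseteq> {..<dim_col M} \<and>
     card I = r \<and> card J = r \<and> trop_nonsingular (submatrix M I J)}"

lemma trop_rank_attained: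
  "\<exists>I J. I \<subseteq> {..<dim_row M} \<and> J \<subseteq> {..<dim_col M} \<and>
     card I = trop_rank M \<and> card J = trop_rank M \<and> trop_nonsingular (submatrix M I J)"
proof -
  let ?R = "{r. \<exists>I J. I \<subseteq> {..<dim_row M} \<and> J \<subseteq> {..<dim_col M} \<and>
     card I = r \<and> card J = r \<and> trop_nonsingular (submatrix M I J)}"
  have "finite ?R"
  proof (rule finite_subset)
    show "?R \<subseteq> card ` Pow {..<dim_row M}" by blast
  qed auto
  moreover have "trop_nonsingular (submatrix M {} {})"
    by (simp add: trop_nonsingular_def dim_submatrix trop_weight_def)
  then have "0 \<in> ?R" by (intro CollectI exI[of _ "{}"]) simp
  ultimately have "Max ?R \<in> ?R" by (intro Max_in) auto
  then show ?thesis unfolding trop_rank_def by blast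
qed

end

theory Submission
  imports Defs "HOL-Analysis.Brouwer_Fixpoint"
begin

text \<open>Let the columns of the matrix be points \<open>v\<close> of real 5-space. A lift of rank at most 3 exists if the
  columns lie in one tropical plane, since over a residue field with at least four elements every
  tropical plane with finite Pluecker coordinates is the tropicalisation of a 3-dimensional subspace
  \<open>L\<close>, and every real point of the plane lifts to \<open>L\<close>: one adds up suitable circuits of \<open>L\<close>, each
  supported on three coordinates, with coefficients that avoid three values of the residue field.

  Tropical rank at most 3 makes any four rows tropically dependent; by Brouwer's theorem, hyperplanes
  without a common point would give a non-singular minor. Let \<open>w a\<close> be a dependency of the rows other
  than \<open>a\<close>. The tropical planes to be found are the tropical lines (trees with five leaves)
  inside the set of all dependencies of the five rows, which is tropically convex. The segment from
  \<open>w a\<close> to \<open>w b\<close> extends to such a line if it has three different break points, i.e. if \<open>w b - w a\<close>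
  takes three different values. If some \<open>w a\<close> is not unique up to constants, then three rows are
  dependent, or there is a one-parameter family of dependencies; both cases are settled directly.
  Finally, if all \<open>w a\<close> are unique and all segments have coinciding break points, then either all
  coincide and the line is a star, or two leaves branch off together and uniqueness shows that
  they can be separated by an edge of suitable length.\<close>

section \<open>Tropical planes in five coordinates\<close>

text \<open>Stated without a minimum, so that on a finite set it unfolds to a Boolean combination of
  inequalities.\<close>

definition ties :: "'i set \<Rightarrow> ('i \<Rightarrow> real) \<Rightarrow> bool" where
  "ties S f \<longleftrightarrow> (\<forall>i\<in>S. \<exists>j\<in>S. j \<noteq> i \<and> f j \<le> f i)"

text \<open>The minimum is attained at least twice, spelled out for three and four numbers, so that
  everything that concerns a single column is a problem of linear real arithmetic.\<close>

definition tie3 :: "real \<Rightarrow> real \<Rightarrow> real \<Rightarrow> bool" where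
  "tie3 x y z \<longleftrightarrow> (y \<le> x \<or> z \<le> x) \<and> (x \<le> y \<or> z \<le> y) \<and> (x \<le> z \<or> y \<le> z)"

definition tie4 :: "real \<Rightarrow> real \<Rightarrow> real \<Rightarrow> real \<Rightarrow> bool" where
  "tie4 x y z w \<longleftrightarrow> (y \<le> x \<or> z \<le> x \<or> w \<le> x) \<and> (x \<le> y \<or> z \<le> y \<or> w \<le> y) \<and>
     (x \<le> z \<or> y \<le> z \<or> w \<le> z) \<and> (x \<le> w \<or> y \<le> w \<or> z \<le> w)"

text \<open>The tropical plane in 4-space that is dual to the tropical line, i.e. the tree, with cherries
  \<open>a, b\<close> and \<open>k, l\<close> on edges of lengths \<open>A\<close> and \<open>B\<close>, and with the leaf \<open>m\<close> between them.
  The five conditions are its circuits. Every tropical plane with finite Pluecker coordinates is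
  of this form, up to a translation and a permutation of the coordinates.\<close>

definition plane :: "real \<Rightarrow> real \<Rightarrow> real \<Rightarrow> real \<Rightarrow> real \<Rightarrow> real \<Rightarrow> real \<Rightarrow> bool" where
  "plane A B xa xb xm xk xl \<longleftrightarrow> tie4 xa xb xk xl \<and> tie4 (A + xb) xk xl xm \<and>
     tie4 (A + xa) xk xl xm \<and> tie4 (B + xl) xa xb xm \<and> tie4 (B + xk) xa xb xm"

definition five :: "nat \<Rightarrow> nat \<Rightarrow> nat \<Rightarrow> nat \<Rightarrow> nat \<Rightarrow> bool" where
  "five a b c d e \<longleftrightarrow> {a, b, c, d, e} = {..<5}"

text \<open>The coefficient at \<open>a\<close> is thought of as infinite, so that
  \<open>x a\<close> may hold any value.\<close>

definition dep :: "(nat \<Rightarrow> real) set \<Rightarrow> nat \<Rightarrow> (nat \<Rightarrow> real) \<Rightarrow> bool" where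
  "dep C a x \<longleftrightarrow> (\<forall>v\<in>C. ties ({..<5} - {a}) (\<lambda>i. x i + v i))"

definition quads_dep :: "(nat \<Rightarrow> real) set \<Rightarrow> bool" where
  "quads_dep C \<longleftrightarrow> finite C \<and> (\<forall>a<5. \<exists>x. dep C a x)"

definition coplanar :: "(nat \<Rightarrow> real) set \<Rightarrow> bool" where
  "coplanar C \<longleftrightarrow> (\<exists>a b m k l A B p. five a b m k l \<and> 0 \<le> A \<and> 0 \<le> B \<and>
     (\<forall>v\<in>C. plane A B (p a + v a) (p b + v b) (p m + v m) (p k + v k) (p l + v l)))"

lemma five_distinct: "five a b c d e \<Longrightarrow> distinct [a, b, c, d, e]"
proof -
  assume "five a b c d e"
  then have "set [a, b, c, d, e] = {..<5}" by (simp add: five_def)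
  then have "card (set [a, b, c, d, e]) = length [a, b, c, d, e]" by simp
  then show ?thesis by (rule card_distinct)
qed

lemma five_less: "five a b c d e \<Longrightarrow> a < 5 \<and> b < 5 \<and> c < 5 \<and> d < 5 \<and> e < 5"
  unfolding five_def by blast

lemma five_remove: "five a b c d e \<Longrightarrow> {..<5} - {a} = {b, c, d, e}"
  using five_distinct[of a b c d e] unfolding five_def by auto

lemma ties_tie4:
  "distinct [b, c, d, e] \<Longrightarrow> ties {b, c, d, e} f \<longleftrightarrow> tie4 (f b) (f c) (f d) (f e)"
  unfolding ties_def tie4_def by auto

lemma dep_iff:
  assumes "five a b c d e"
  shows "dep C a x \<longleftrightarrow> (\<forall>v\<in>C. tie4 (x b + v b) (x c + v c) (x d + v d) (x e + v e))"
  using five_distinct[OF assms] ties_tie4[of b c d e]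
  unfolding dep_def five_remove[OF assms] by auto

lemma coplanarI:
  assumes "five a b m k l" "0 \<le> A" "0 \<le> B"
    "\<And>v. v \<in> C \<Longrightarrow> plane A B (p a + v a) (p b + v b) (p m + v m) (p k + v k) (p l + v l)"
  shows "coplanar C"
  using assms unfolding coplanar_def by blast

lemma coplanarI0:
  assumes "five a b m k l" "0 \<le> A" "0 \<le> B"
    "\<And>v. v \<in> C \<Longrightarrow> plane A B (v a) (v b) (v m) (v k) (v l)"
  shows "coplanar C"
  using coplanarI[of a b m k l A B C "\<lambda>_. 0"] assms by simp

definition shift :: "(nat \<Rightarrow> real) \<Rightarrow> (nat \<Rightarrow> real) set \<Rightarrow> (nat \<Rightarrow> real) set" where
  "shift p C = (\<lambda>v i. p i + v i) ` C"

lemma coplanar_shift: "coplanar (shift p C) \<Longrightarrow> coplanar C"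
proof -
  assume "coplanar (shift p C)"
  then obtain a b m k l A B q where *: "five a b m k l" "0 \<le> A" "0 \<le> B"
    "\<forall>v\<in>shift p C. plane A B (q a + v a) (q b + v b) (q m + v m) (q k + v k) (q l + v l)"
    unfolding coplanar_def by blast
  show ?thesis
    by (rule coplanarI[OF *(1-3), of _ "\<lambda>i. q i + p i"]) (use *(4) in \<open>auto simp: shift_def add.assoc\<close>)
qed

lemma dep_shift: "dep (shift p C) a x \<longleftrightarrow> dep C a (\<lambda>i. x i + p i)"
  by (simp add: dep_def shift_def add.assoc)

lemma quads_dep_shift: "quads_dep C \<Longrightarrow> quads_dep (shift p C)"
proof -
  assume C: "quads_dep C"
  have "\<exists>x. dep (shift p C) a x" if a: "a < 5" for a
  proof -
    obtain x where "dep C a x" using C a unfolding quads_dep_def by blast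
    then have "dep (shift p C) a (\<lambda>i. x i - p i)" by (simp add: dep_shift)
    then show ?thesis by blast
  qed
  then show ?thesis using C by (simp add: quads_dep_def shift_def)
qed

section \<open>Segments with three different break points\<close>

lemma sort3:
  fixes g :: "nat \<Rightarrow> real"
  obtains k' l' m' where "{k', l', m'} = {k, l, m}" "g k' \<le> g l'" "g l' \<le> g m'"
proof -
  define xs where "xs = sort_key g [k, l, m]"
  have "length xs = 3" "set xs = {k, l, m}" "sorted (map g xs)" by (auto simp: xs_def)
  then show ?thesis using that by (auto simp: length_Suc_conv numeral_3_eq_3)
qed

lemma sort4:
  fixes g :: "nat \<Rightarrow> real"
  obtains b' k' l' m' where "{b', k', l', m'} = {b, k, l, m}" "g b' \<le> g k'" "g k' \<le> g l'" "g l' \<le> g m'"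
proof -
  define xs where "xs = sort_key g [b, k, l, m]"
  have "length xs = Suc (Suc (Suc (Suc 0)))" "set xs = {b, k, l, m}" "sorted (map g xs)" by (auto simp: xs_def)
  then show ?thesis using that by (auto simp: length_Suc_conv)
qed

text \<open>The tropical segment that joins two dependencies leaves them in the directions \<open>a\<close> and
  \<open>b\<close>; the leaves \<open>k, l, m\<close> are attached where the segment breaks.\<close>

lemma plane_of_pair:
  assumes "tie4 (xb + cb) (xk + ck) (xl + cl) (xm + cm)"
    "tie4 (ya + ca) (yk + ck) (yl + cl) (ym + cm)"
    "yk - xk < yl - xl" "yl - xl < ym - xm"
  shows "plane ((yl - xl) - (yk - xk)) ((ym - xm) - (yl - xl))
    (ya - (yl - xl) + ca) (yk - (yl - xl) + ck) (xl + cl) (xb + cb) (xm + cm)"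
  using assms unfolding plane_def tie4_def by argo

lemma generic_pair_coplanar:
  assumes f: "five a b k l m" and x: "dep C a x" and y: "dep C b y"
    and ne: "y k - x k \<noteq> y l - x l" "y k - x k \<noteq> y m - x m" "y l - x l \<noteq> y m - x m"
  shows "coplanar C"
proof -
  obtain k' l' m' where s: "{k', l', m'} = {k, l, m}" "y k' - x k' \<le> y l' - x l'" "y l' - x l' \<le> y m' - x m'"
    using sort3[of k l m "\<lambda>i. y i - x i"] by metis
  have f': "five a b k' l' m'" using f s(1) unfolding five_def by (metis insert_commute)
  have d: "distinct [a, b, k', l', m']" by (rule five_distinct[OF f'])
  have "y k' - x k' \<noteq> y l' - x l'" "y l' - x l' \<noteq> y m' - x m'"
    using ne s(1) d by (smt (verit) distinct_length_2_or_more insert_iff singletonD)+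
  then have lt: "y k' - x k' < y l' - x l'" "y l' - x l' < y m' - x m'" using s by auto
  have f2: "five a k' l' b m'" and f3: "five b a k' l' m'" using f' by (simp_all add: five_def insert_commute)
  \<comment> \<open>The middle break point of the segment: the minimum of \<open>x\<close> and
    \<open>y - (y l' - x l')\<close>, where \<open>x\<close> counts as infinite at \<open>a\<close>
    and \<open>y\<close> at \<open>b\<close>. There the leaf \<open>l'\<close> is attached.\<close>
  define p where "p = x(a := y a - (y l' - x l'), k' := y k' - (y l' - x l'))"
  have p: "p a = y a - (y l' - x l')" "p k' = y k' - (y l' - x l')" "p l' = x l'" "p b = x b" "p m' = x m'"
    using d by (auto simp: p_def)
  show ?thesis
  proof (rule coplanarI[OF f2, where p = p])
    fix v assume "v \<in> C"
    then have "tie4 (x b + v b) (x k' + v k') (x l' + v l') (x m' + v m')"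
      "tie4 (y a + v a) (y k' + v k') (y l' + v l') (y m' + v m')"
      using x y unfolding dep_iff[OF f'] dep_iff[OF f3] by auto
    from plane_of_pair[OF this lt] show "plane ((y l' - x l') - (y k' - x k')) ((y m' - x m') - (y l' - x l'))
       (p a + v a) (p k' + v k') (p l' + v l') (p b + v b) (p m' + v m')"
      unfolding p .
  qed (use lt in auto)
qed

section \<open>Three dependent rows\<close>

lemma finite_bound:
  fixes f :: "'a \<Rightarrow> real"
  assumes "finite C"
  obtains K where "0 \<le> K" "\<And>v. v \<in> C \<Longrightarrow> f v \<le> K"
proof
  show "0 \<le> (\<Sum>v\<in>C. \<bar>f v\<bar>)" by (simp add: sum_nonneg)
  show "f v \<le> (\<Sum>v\<in>C. \<bar>f v\<bar>)" if "v \<in> C" for v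
    using member_le_sum[of v C "\<lambda>v. \<bar>f v\<bar>"] that assms by fastforce
qed

text \<open>If the edge of the cherry \<open>k, l\<close> is long enough, its term never lies below
  the minimum in the last two circuits, and these follow from the dependency of three rows.\<close>

lemma plane_large: "tie3 xa xb xm \<Longrightarrow> tie4 xa xb xk xl \<Longrightarrow> tie4 (A + xb) xk xl xm \<Longrightarrow> tie4 (A + xa) xk xl xm \<Longrightarrow>
   xa - xl \<le> B \<Longrightarrow> xa - xk \<le> B \<Longrightarrow> plane A B xa xb xm xk xl"
  unfolding plane_def tie3_def tie4_def by argo

text \<open>Elimination of \<open>c3\<close>, respectively \<open>c2\<close>, between two
  dependencies. It is unambiguous because \<open>A > 0\<close> prevents \<open>c2\<close> and
  \<open>c3\<close> from cancelling together.\<close>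

lemma plane_of_triple:
  assumes "tie3 c1 c2 c3" "tie4 (A + c2) c3 g4 g5" "A > 0"
  shows "tie4 c1 c2 g4 g5 \<and> tie4 (A + c1) c3 g4 g5"
  using assms unfolding tie3_def tie4_def by argo

text \<open>The case \<open>A = 0\<close> of the same elimination: it fails only where
  \<open>c2\<close> and \<open>c3\<close> cancel each other below everything else.\<close>

lemma star_obstruction:
  assumes "tie3 c1 c2 c3" "tie4 c2 c3 g4 g5" "\<not> (tie4 c1 c2 g4 g5 \<and> tie4 c1 c3 g4 g5)"
  shows "c2 = c3 \<and> c2 < c1 \<and> c2 < g4 \<and> c2 < g5"
  using assms unfolding tie3_def tie4_def by argo

text \<open>Each line of premises says that one of the points \<open>f, g, h\<close> of the real plane lies strictly
  above an apex whose tropical line contains the other two. The three points then form an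
  antichain, and the middle one violates this.\<close>

lemma no_three_hooks:
  assumes "u < f4" "u' < f5" "tie3 0 (g4 - u) (g5 - u')" "tie3 0 (h4 - u) (h5 - u')"
    "v < g4" "v' < g5" "tie3 0 (f4 - v) (f5 - v')" "tie3 0 (h4 - v) (h5 - v')"
    "w < h4" "w' < h5" "tie3 0 (f4 - w) (f5 - w')" "tie3 0 (g4 - w) (g5 - w')"
  shows False
  using assms unfolding tie3_def by argo

lemma triple_plane:
  assumes f: "five a b e k l" and C: "finite C" and t: "\<And>v. v \<in> C \<Longrightarrow> tie3 (v a) (v b) (v e)" and A: "0 \<le> A"
    and p: "\<And>v. v \<in> C \<Longrightarrow> tie4 (v a) (v b) (fk + v k) (fl + v l)"
     "\<And>v. v \<in> C \<Longrightarrow> tie4 (A + v b) (v e) (fk + v k) (fl + v l)"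
     "\<And>v. v \<in> C \<Longrightarrow> tie4 (A + v a) (v e) (fk + v k) (fl + v l)"
  shows "coplanar C"
proof -
  obtain K where K: "0 \<le> K" "\<And>v. v \<in> C \<Longrightarrow> v a - (fk + v k) \<le> K" 
    by (rule finite_bound[OF C, of "\<lambda>v. v a - (fk + v k)"]) blast
  obtain L where L: "0 \<le> L" "\<And>v. v \<in> C \<Longrightarrow> v a - (fl + v l) \<le> L" 
    by (rule finite_bound[OF C, of "\<lambda>v. v a - (fl + v l)"]) blast
  define q where "q = (\<lambda>_. 0::real)(k := fk, l := fl)"
  have q: "q a = 0" "q b = 0" "q e = 0" "q k = fk" "q l = fl"
    using five_distinct[OF f] by (auto simp: q_def)
  show ?thesis
  proof (rule coplanarI[OF f A, of "K + L" _ q])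
    fix v assume v: "v \<in> C"
    have perm: "tie4 (A + v b) (fk + v k) (fl + v l) (v e)" "tie4 (A + v a) (fk + v k) (fl + v l) (v e)"
      using p(2,3)[OF v] unfolding tie4_def by argo+
    have "plane A (K + L) (v a) (v b) (v e) (fk + v k) (fl + v l)"
      by (rule plane_large[OF t[OF v] p(1)[OF v] perm]) (use K L v in fastforce)+
    then show "plane A (K + L) (q a + v a) (q b + v b) (q e + v e) (q k + v k) (q l + v l)"
      by (simp add: q)
  qed (use K L in auto)
qed

text \<open>Rows \<open>b\<close> and \<open>e\<close> do not cancel together here, so elimination
  between \<open>w\<close> and the dependency of three rows supplies the missing circuits. The
  cherry \<open>a, b\<close> gets an edge of length \<open>w b - w e\<close>.\<close>

lemma triple_unequal:
  assumes f: "five a b e k l" and C: "finite C" and t: "\<And>v. v \<in> C \<Longrightarrow> tie3 (v a) (v b) (v e)"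
    and w: "dep C a w" and ne: "w e < w b"
  shows "coplanar C"
proof -
  have T: "tie4 (v a) (v b) (w k - w e + v k) (w l - w e + v l) \<and>
      tie4 ((w b - w e) + v a) (v e) (w k - w e + v k) (w l - w e + v l) \<and>
      tie4 ((w b - w e) + v b) (v e) (w k - w e + v k) (w l - w e + v l)" if v: "v \<in> C" for v
  proof -
    have "tie4 (w b + v b) (w e + v e) (w k + v k) (w l + v l)"
      using w v unfolding dep_iff[OF f] by blast
    then have *: "tie4 ((w b - w e) + v b) (v e) (w k - w e + v k) (w l - w e + v l)"
      unfolding tie4_def by argo
    show ?thesis using plane_of_triple[OF t[OF v] *] * ne by simp
  qed
  show ?thesis
    by (rule triple_plane[OF f C t, of "w b - w e"]) (use T ne in auto)
qed

text \<open>Both orders of \<open>b\<close> and \<open>e\<close> are excluded by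
  \<open>triple_unequal\<close>. With equal coefficients, only a column as in
  \<open>star_obstruction\<close> can prevent a plane with \<open>A = 0\<close>.\<close>

lemma triple_star:
  assumes f: "five a b e k l" and C: "finite C" and t: "\<And>v. v \<in> C \<Longrightarrow> tie3 (v a) (v b) (v e)"
    and w: "dep C a w" and nc: "\<not> coplanar C"
  shows "w b = w e \<and> (\<exists>v\<in>C. v b = v e \<and> v b < v a \<and> v b - v k < w k - w b \<and> v b - v l < w l - w b)"
proof -
  have f': "five a e b k l" using f by (simp_all add: five_def insert_commute)
  have t': "tie3 (v a) (v e) (v b)" if "v \<in> C" for v using t[OF that] unfolding tie3_def by argo
  have eq: "w b = w e"
  proof (rule antisym)
    show "w b \<le> w e" using triple_unequal[OF f C t w] nc by (metis not_le)
    show "w e \<le> w b" using triple_unequal[OF f' C t' w] nc by (metis not_le)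
  qed
  have *: "tie4 (v b) (v e) (w k - w b + v k) (w l - w b + v l)" if v: "v \<in> C" for v
  proof -
    have "tie4 (w b + v b) (w b + v e) (w k + v k) (w l + v l)"
      using w v unfolding dep_iff[OF f] by (simp add: eq)
    then show ?thesis unfolding tie4_def by argo
  qed
  have "\<exists>v\<in>C. \<not> (tie4 (v a) (v b) (w k - w b + v k) (w l - w b + v l) \<and> tie4 (v a) (v e) (w k - w b + v k) (w l - w b + v l))"
  proof (rule ccontr)
    assume "\<not> ?thesis"
    then have **: "tie4 (v a) (v b) (w k - w b + v k) (w l - w b + v l)" "tie4 (v a) (v e) (w k - w b + v k) (w l - w b + v l)" if "v \<in> C" for v
      using that by blast+
    have "coplanar C"
      by (rule triple_plane[OF f C t, of 0 "w k - w b" "w l - w b"]) (simp_all only: add_0 order.refl * **)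
    with nc show False ..
  qed
  then obtain v where v: "v \<in> C" "\<not> (tie4 (v a) (v b) (w k - w b + v k) (w l - w b + v l) \<and> tie4 (v a) (v e) (w k - w b + v k) (w l - w b + v l))"
    by blast
  from star_obstruction[OF t[OF v(1)] *[OF v(1)] v(2)]
  have "v b = v e \<and> v b < v a \<and> v b - v k < w k - w b \<and> v b - v l < w l - w b" by linarith
  with v(1) eq show ?thesis by blast
qed

text \<open>Row \<open>a\<close> lies strictly above row \<open>e\<close> in column
  \<open>v\<close>, so the tie occurs among \<open>e\<close>, \<open>k\<close>, \<open>l\<close>:
  the point given by \<open>w\<close> lies on the tropical line whose apex is given by
  \<open>v\<close>.\<close>

lemma triple_hook:
  assumes f: "five b a e k l" and w: "dep C b w" "w a = w e" and v: "v \<in> C" "v b = v e" "v b < v a"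
  shows "tie3 0 (w k - w a - (v b - v k)) (w l - w a - (v b - v l))"
proof -
  have "tie4 (w a + v a) (w a + v b) (w k + v k) (w l + v l)"
    using w v unfolding dep_iff[OF f] by force
  then show ?thesis using v(3) unfolding tie4_def tie3_def by argo
qed

text \<open>The dependencies omitting \<open>a\<close>, \<open>b\<close> and \<open>e\<close> give
  three points of the real plane, and the columns from \<open>triple_star\<close> give an apex
  strictly below each. By \<open>triple_hook\<close> the line of each apex contains the other two
  points, contrary to \<open>no_three_hooks\<close>.\<close>

lemma triple_coplanar0:
  assumes f: "five a b e k l" and C: "quads_dep C" and t: "\<And>v. v \<in> C \<Longrightarrow> tie3 (v a) (v b) (v e)"
  shows "coplanar C"
proof (rule ccontr)
  assume nc: "\<not> coplanar C"
  have fin: "finite C" using C by (simp add: quads_dep_def)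
  have fs: "five b a e k l" "five e a b k l" "five a e b k l" "five b e a k l" "five e b a k l" using f by (simp_all add: five_def insert_commute)
  obtain x y z where w: "dep C a x" "dep C b y" "dep C e z"
  proof -
    have ex: "\<exists>x. dep C i x" if "i < 5" for i using C that by (simp add: quads_dep_def)
    show thesis using that ex[of a] ex[of b] ex[of e] five_less[OF f] by blast
  qed
  have t2: "tie3 (v b) (v a) (v e)" "tie3 (v e) (v a) (v b)" if "v \<in> C" for v
    using t[OF that] unfolding tie3_def by argo+
  obtain u where x: "x b = x e" and u: "u \<in> C" "u b = u e" "u b < u a" "u b - u k < x k - x b" "u b - u l < x l - x b"
    using triple_star[OF f fin t w(1) nc] by blast
  obtain u' where y: "y a = y e" and u': "u' \<in> C" "u' a = u' e" "u' a < u' b" "u' a - u' k < y k - y a" "u' a - u' l < y l - y a"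
    using triple_star[OF fs(1) fin t2(1) w(2) nc] by blast
  obtain u'' where z: "z a = z b" and u'': "u'' \<in> C" "u'' a = u'' b" "u'' a < u'' e" "u'' a - u'' k < z k - z a" "u'' a - u'' l < z l - z a"
    using triple_star[OF fs(2) fin t2(2) w(3) nc] by blast
  have u23: "u e = u b" "u e < u a" and u'23: "u' e = u' a" "u' e < u' b" and u''23: "u'' b = u'' a" "u'' b < u'' e"
    using u u' u'' by linarith+
  have 1: "tie3 0 (y k - y a - (u b - u k)) (y l - y a - (u b - u l))"
    by (rule triple_hook[OF fs(1) w(2) y u(1-3)])
  have 2: "tie3 0 (z k - z a - (u b - u k)) (z l - z a - (u b - u l))"
    using triple_hook[OF fs(2) w(3) z u(1) u23] unfolding u23(1) .
  have 3: "tie3 0 (x k - x b - (u' a - u' k)) (x l - x b - (u' a - u' l))"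
    by (rule triple_hook[OF f w(1) x u'(1-3)])
  have 4: "tie3 0 (z k - z a - (u' a - u' k)) (z l - z a - (u' a - u' l))"
    using triple_hook[OF fs(5) w(3) z[symmetric] u'(1) u'23] unfolding u'23(1) z .
  have 5: "tie3 0 (x k - x b - (u'' a - u'' k)) (x l - x b - (u'' a - u'' l))"
    using triple_hook[OF fs(3) w(1) x[symmetric] u''(1-3)] unfolding x .
  have 6: "tie3 0 (y k - y a - (u'' a - u'' k)) (y l - y a - (u'' a - u'' l))"
    using triple_hook[OF fs(4) w(2) y[symmetric] u''(1) u''23] unfolding u''23(1) y .
  show False
    using no_three_hooks[OF u(4,5) 1 2 u'(4,5) 3 4 u''(4,5) 5 6] .
qed

lemma triple_coplanar:
  assumes f: "five a b e k l" and C: "quads_dep C"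
    and t: "\<And>v. v \<in> C \<Longrightarrow> tie3 (x a + v a) (x b + v b) (x e + v e)"
  shows "coplanar C"
proof -
  have "tie3 (u a) (u b) (u e)" if "u \<in> shift x C" for u
    using that t unfolding shift_def by blast
  from triple_coplanar0[OF f quads_dep_shift[OF C] this] show ?thesis
    by (auto intro: coplanar_shift)
qed

section \<open>One-parameter families of dependencies\<close>

text \<open>The columns that are orthogonal to \<open>(0, 0, s, s)\<close> for all \<open>s\<close> between \<open>s0\<close> and \<open>s1\<close>.\<close>

definition ribbon :: "real \<Rightarrow> real \<Rightarrow> real \<Rightarrow> real \<Rightarrow> real \<Rightarrow> real \<Rightarrow> bool" where
  "ribbon s0 s1 c1 c2 c3 c4 \<longleftrightarrow> (c1 = c2 \<or> c3 = c4) \<and>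
     (c3 \<noteq> c4 \<longrightarrow> c1 \<le> s0 + c3 \<and> c1 \<le> s0 + c4) \<and> (c1 \<noteq> c2 \<longrightarrow> s1 + c3 \<le> c1 \<and> s1 + c3 \<le> c2)"

text \<open>The two ends suffice: every member between them is a tropical combination of the
  two.\<close>

lemma ribbonI:
  assumes "tie4 c1 c2 (s0 + c3) (s0 + c4)" "tie4 c1 c2 (s1 + c3) (s1 + c4)" "s0 < s1"
  shows "ribbon s0 s1 c1 c2 c3 c4"
  using assms unfolding tie4_def ribbon_def by argo

lemma ribbon_between:
  assumes "ribbon s0 s1 c1 c2 c3 c4" "s0 \<le> s" "s \<le> s1"
  shows "tie4 c1 c2 (s + c3) (s + c4)"
  using assms unfolding tie4_def ribbon_def by argo

text \<open>If \<open>c3 = c4\<close>, lowering both terms preserves the tie. Otherwise the ribbon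
  keeps \<open>c2\<close> below both lowered terms, so the minimum stays where it was.
  \<open>ribbon_raise\<close> is the counterpart at the other end.\<close>

lemma ribbon_lower:
  assumes "tie4 c2 (A + c3) (A + c4) (h + c5)" "ribbon s0 s1 c1 c2 c3 c4" "s0 < s1" "s0 < A"
  shows "tie4 c2 (s0 + c3) (s0 + c4) (h + c5)"
  using assms unfolding tie4_def ribbon_def by argo

lemma ribbon_raise:
  assumes "tie4 c1 c2 (B + c4) (g + c5)" "ribbon s0 s1 c1 c2 c3 c4" "s0 < s1" "B < s1"
  shows "tie4 c1 c2 (s1 + c4) (g - B + s1 + c5)"
  using assms unfolding tie4_def ribbon_def by argo

text \<open>In terms of the parameter of the ribbon, the leaves 1 and 2 branch off at
  \<open>A\<close>, the leaves 3 and 4 at \<open>B\<close>, and leaf 5 at \<open>s\<close>.\<close>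

lemma plane_of_ribbon:
  assumes "tie4 c2 (A + c3) (A + c4) (h + c5)" "tie4 c1 c2 (B + c4) (g + c5)"
    "ribbon s0 s1 c1 c2 c3 c4" "s0 < s1" "A \<le> s0" "s1 \<le> B" "s = g - h + A" "s0 \<le> s" "s \<le> s1"
  shows "plane (s - A) (B - s) c1 c2 (g + c5) (s + c3) (s + c4)"
  using assms unfolding tie4_def ribbon_def plane_def by argo

text \<open>In a column for which the bound \<open>s1\<close> is sharp, the second premise forces
  \<open>g + c5 = c3 + s1\<close> and the first one \<open>A + c3 <= h + c5\<close>.\<close>

lemma ribbon_attach_le:
  assumes "tie4 c2 (A + c3) (A + c4) (h + c5)" "tie4 c1 c2 (B + c4) (g + c5)"
    "c3 = c4" "c1 \<noteq> c2" "c1 \<le> c3 + s1 \<or> c2 \<le> c3 + s1" "c3 + s1 \<le> c1" "c3 + s1 \<le> c2"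
    "s0 < s1" "A \<le> s0" "s1 < B"
  shows "g - h + A \<le> s1"
  using assms unfolding tie4_def by argo

text \<open>The same for a column in which the bound \<open>s0\<close> is sharp: now the first
  premise determines \<open>c5\<close> and the second one bounds it.\<close>

lemma ribbon_attach_ge:
  assumes "tie4 c2 (A + c3) (A + c4) (h + c5)" "tie4 c1 c2 (B + c4) (g + c5)"
    "c1 = c2" "c3 \<noteq> c4" "c3 + s0 \<le> c1 \<or> c4 + s0 \<le> c1" "c1 \<le> c3 + s0" "c1 \<le> c4 + s0"
    "s0 < s1" "A < s0" "s1 \<le> B"
  shows "s0 \<le> g - h + A"
  using assms unfolding tie4_def by argo

lemma avoid_two:
  fixes s0 s1 :: real
  assumes "s0 < s1"
  obtains s where "s0 < s" "s < s1" "s \<noteq> p" "s \<noteq> q"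
proof -
  have "infinite ({s0<..<s1} - {p, q})" using assms by (intro Diff_infinite_finite) auto
  then obtain s where "s \<in> {s0<..<s1} - {p, q}" by (meson finite.emptyI finite_subset subsetI)
  then show ?thesis using that by auto
qed

text \<open>Otherwise \<open>w\<close> and a member of the ribbon with generic \<open>s\<close> are
  joined by a segment with three different break points.\<close>

lemma ribbon_equal:
  assumes f: "five a b k l m" and w: "dep C a w" and s: "s0 < s1"
    and d: "\<And>v s. v \<in> C \<Longrightarrow> s0 \<le> s \<Longrightarrow> s \<le> s1 \<Longrightarrow> tie4 (v a) (v b) (s + v k) (s + v l)"
    and nc: "\<not> coplanar C"
  shows "w k = w l"
proof (rule ccontr)
  assume ne: "w k \<noteq> w l"
  obtain s where s: "s0 < s" "s < s1" "s \<noteq> w k - w b" "s \<noteq> w l - w b" using avoid_two[OF s] .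
  define x where "x = (\<lambda>_. 0::real)(k := s, l := s)"
  have x: "x a = 0" "x b = 0" "x k = s" "x l = s" using five_distinct[OF f] by (auto simp: x_def)
  have f1: "five m a b k l" using f by (simp_all add: five_def insert_commute)
  have "dep C m x" unfolding dep_iff[OF f1] x using d s by auto
  from generic_pair_coplanar[OF f1 this w] ne s nc show False by (auto simp: x)
qed

lemma ribbon_coplanar0:
  assumes f: "five a b k l m" and C: "quads_dep C" and s: "s0 < s1"
    and d: "\<And>v. v \<in> C \<Longrightarrow> tie4 (v a) (v b) (s0 + v k) (s0 + v l)"
           "\<And>v. v \<in> C \<Longrightarrow> tie4 (v a) (v b) (s1 + v k) (s1 + v l)"
  shows "coplanar C"
proof (rule ccontr)
  assume nc: "\<not> coplanar C"
  have fin: "finite C" using C by (simp add: quads_dep_def)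
  have f2: "five k l m a b" "five a b m k l" "five k l a b m" "five k a b l m" "five a k b l m" using f by (simp_all add: five_def insert_commute)
  have rib: "ribbon s0 s1 (v a) (v b) (v k) (v l)" if "v \<in> C" for v
    by (rule ribbonI[OF d[OF that] s])
  define P where "P = {v \<in> C. v k \<noteq> v l}"
  define Q where "Q = {v \<in> C. v a \<noteq> v b}"
  \<comment> \<open>Two rows that agree in all columns are dependent together with any third row of
    large coefficient.\<close>
  have triv: "\<exists>v\<in>C. v i \<noteq> v j" if f': "five i j r o' q" for i j r o' q
  proof (rule ccontr)
    assume "\<not> ?thesis"
    then have eq: "v i = v j" if "v \<in> C" for v using that by blast
    obtain K where K: "\<And>v. v \<in> C \<Longrightarrow> v i - v r \<le> K"
      by (rule finite_bound[OF fin, of "\<lambda>v. v i - v r"]) blast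
    define x where "x = (\<lambda>_. 0::real)(r := K)"
    have "x i = 0" "x j = 0" "x r = K" using five_distinct[OF f'] by (auto simp: x_def)
    then have "tie3 (x i + v i) (x j + v j) (x r + v r)" if "v \<in> C" for v
      using eq[OF that] K[OF that] by (simp add: tie3_def)
    from triple_coplanar[OF f' C this] nc show False by blast
  qed
  have P: "finite P" "P \<noteq> {}" and Q: "finite Q" "Q \<noteq> {}"
    using fin triv[OF f] triv[OF f2(1)] by (auto simp: P_def Q_def)
  \<comment> \<open>The ribbon is widened as far as the columns allow. The extremal columns
    \<open>vp\<close> and \<open>vq\<close> make its two ends sharp.\<close>
  define t0 where "t0 = Max ((\<lambda>v. v a - min (v k) (v l)) ` P)"
  define t1 where "t1 = Min ((\<lambda>v. min (v a) (v b) - v k) ` Q)"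
  have "t0 \<in> (\<lambda>v. v a - min (v k) (v l)) ` P" unfolding t0_def using P by (intro Max_in) auto
  then obtain vp where vp: "vp \<in> P" "t0 = vp a - min (vp k) (vp l)" by blast
  have "t1 \<in> (\<lambda>v. min (v a) (v b) - v k) ` Q" unfolding t1_def using Q by (intro Min_in) auto
  then obtain vq where vq: "vq \<in> Q" "t1 = min (vq a) (vq b) - vq k" by blast
  have t0: "v a - min (v k) (v l) \<le> t0" if "v \<in> P" for v unfolding t0_def using P that by simp
  have t1: "t1 \<le> min (v a) (v b) - v k" if "v \<in> Q" for v unfolding t1_def using Q that by simp
  have "t0 \<le> s0" "s1 \<le> t1"
    using rib[of vp] rib[of vq] vp vq by (auto simp: P_def Q_def ribbon_def min_def)
  then have t: "t0 < t1" using s by simp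
  have ribt: "ribbon t0 t1 (v a) (v b) (v k) (v l)" if "v \<in> C" for v
  proof -
    have "v k \<noteq> v l \<longrightarrow> v a \<le> t0 + v k \<and> v a \<le> t0 + v l"
      using t0[of v] that by (auto simp: P_def)
    moreover have "v a \<noteq> v b \<longrightarrow> t1 + v k \<le> v a \<and> t1 + v k \<le> v b"
      using t1[of v] that by (auto simp: Q_def)
    ultimately show ?thesis using rib[OF that] unfolding ribbon_def by blast
  qed
  have between: "tie4 (v a) (v b) (s + v k) (s + v l)" if "v \<in> C" "t0 \<le> s" "s \<le> t1" for v s
    using ribbon_between[OF ribt[OF that(1)] that(2,3)] .
  have between': "tie4 (v k) (v l) (s + v a) (s + v b)" if "v \<in> C" "- t1 \<le> s" "s \<le> - t0" for v s
    using between[OF that(1), of "- s"] that(2,3) unfolding tie4_def by argo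
  obtain w where w: "dep C a w" using C five_less[OF f] unfolding quads_dep_def by blast
  obtain z where z: "dep C k z" using C five_less[OF f] unfolding quads_dep_def by blast
  have weq: "w k = w l" by (rule ribbon_equal[OF f w t between nc])
  have zeq: "z a = z b" by (rule ribbon_equal[OF f2(3) z _ between' nc]) (use t in auto)
  define A0 where "A0 = w k - w b"
  define h where "h = w m - w b"
  define B0 where "B0 = z l - z a"
  define g0 where "g0 = z m - z a"
  have wA: "tie4 (v b) (A0 + v k) (A0 + v l) (h + v m)" if "v \<in> C" for v
  proof -
    have "tie4 (w b + v b) (w k + v k) (w l + v l) (w m + v m)" using w that unfolding dep_iff[OF f] by blast
    then show ?thesis using weq unfolding A0_def h_def tie4_def by argo
  qed
  have zB: "tie4 (v a) (v b) (B0 + v l) (g0 + v m)" if "v \<in> C" for v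
  proof -
    have "tie4 (z a + v a) (z b + v b) (z l + v l) (z m + v m)" using z that unfolding dep_iff[OF f2(4)] by blast
    then show ?thesis using zeq unfolding B0_def g0_def tie4_def by argo
  qed
  \<comment> \<open>\<open>ribbon_lower\<close> and \<open>ribbon_raise\<close> move the ends of the
    edge out of the interior of the ribbon.\<close>
  define A where "A = (if t0 < A0 then t0 else A0)"
  define B where "B = (if B0 < t1 then t1 else B0)"
  define g where "g = (if B0 < t1 then g0 - B0 + t1 else g0)"
  have AB: "A \<le> t0" "t1 \<le> B" by (auto simp: A_def B_def)
  have wA': "tie4 (v b) (A + v k) (A + v l) (h + v m)" if "v \<in> C" for v
    using wA[OF that] ribbon_lower[OF wA[OF that] ribt[OF that] t] unfolding A_def by auto
  have zB': "tie4 (v a) (v b) (B + v l) (g + v m)" if "v \<in> C" for v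
    using zB[OF that] ribbon_raise[OF zB[OF that] ribt[OF that] t] unfolding B_def g_def by auto
  define s where "s = g - h + A"
  show False
  proof (cases "t0 \<le> s \<and> s \<le> t1")
    case True
    define p where "p = (\<lambda>_. 0::real)(m := g, k := s, l := s)"
    have p: "p a = 0" "p b = 0" "p m = g" "p k = s" "p l = s" using five_distinct[OF f] by (auto simp: p_def)
    have pl: "plane (s - A) (B - s) (v a) (v b) (g + v m) (s + v k) (s + v l)" if v: "v \<in> C" for v
      by (rule plane_of_ribbon[OF wA'[OF v] zB'[OF v] ribt[OF v] t AB s_def]) (use True in auto)
    have "coplanar C"
      by (rule coplanarI[OF f2(2), of "s - A" "B - s" _ p])
        (use True AB pl in \<open>auto simp: p\<close>)
    with nc show False ..
  next
    case False
    have vq': "vq k = vq l" "vq a \<noteq> vq b" "vq a \<le> vq k + t1 \<or> vq b \<le> vq k + t1" "vq k + t1 \<le> vq a" "vq k + t1 \<le> vq b" "vq \<in> C"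
      using vq ribt[of vq] by (auto simp: Q_def ribbon_def)
    have vp': "vp a = vp b" "vp k \<noteq> vp l" "vp k + t0 \<le> vp a \<or> vp l + t0 \<le> vp a" "vp a \<le> vp k + t0" "vp a \<le> vp l + t0" "vp \<in> C"
      using vp ribt[of vp] by (auto simp: P_def ribbon_def)
    have "t1 < s \<Longrightarrow> B \<le> t1"
      using ribbon_attach_le[OF wA'[OF vq'(6)] zB'[OF vq'(6)] vq'(1-3) _ _ t AB(1)] vq'(4-6) by (fastforce simp: s_def)
    moreover have "s < t0 \<Longrightarrow> t0 \<le> A"
      using ribbon_attach_ge[OF wA'[OF vp'(6)] zB'[OF vp'(6)] vp'(1-5) t _ AB(2)] by (fastforce simp: s_def)
    \<comment> \<open>If \<open>s\<close> exceeds \<open>t1\<close> then \<open>B = t1\<close>, and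
      if it is below \<open>t0\<close> then \<open>A = t0\<close>. In both cases \<open>s\<close>
      differs from \<open>A\<close> and \<open>B\<close>, so a segment with three different break
      points arises.\<close>
    ultimately have ne: "g - h \<noteq> 0" "g - h \<noteq> B - A" "B - A \<noteq> 0"
      using False AB t by (auto simp: s_def)
    define x where "x = (\<lambda>_. 0::real)(k := A, l := A, m := h)"
    define y where "y = (\<lambda>_. 0::real)(l := B, m := g)"
    have x: "x b = 0" "x k = A" "x l = A" "x m = h" and y: "y a = 0" "y b = 0" "y l = B" "y m = g"
      using five_distinct[OF f] by (auto simp: x_def y_def)
    have "dep C a x" unfolding dep_iff[OF f] x using wA' by simp
    moreover have "dep C k y" unfolding dep_iff[OF f2(4)] y using zB' by simp
    ultimately show False
      using generic_pair_coplanar[OF f2(5), of C x y] ne nc by (simp add: x y)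
  qed
qed

section \<open>Uniqueness of dependencies\<close>

text \<open>If the other three terms had a strict minimum, \<open>fb\<close> would have to equal it,
  and adding the smallest constant would make the first term a strict minimum.\<close>

lemma tie4_drop_slowest:
  assumes "tie4 fb fk fl fm" "tie4 (\<beta> + fb) (\<kappa> + fk) (l + fl) (\<mu> + fm)" "\<beta> < \<kappa>" "\<beta> < l" "\<beta> < \<mu>"
  shows "tie3 fk fl fm"
  using assms unfolding tie3_def tie4_def by argo

lemma tie4_drop_fastest:
  assumes "tie4 fb fk fl fm" "tie4 (\<beta> + fb) (\<kappa> + fk) (l + fl) (\<mu> + fm)" "\<beta> < \<mu>" "\<kappa> < \<mu>" "l < \<mu>"
  shows "tie3 (\<beta> + fb) (\<kappa> + fk) (l + fl)"
  using assms unfolding tie3_def tie4_def by argo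

text \<open>When the differences are sorted, a strict first or last step leaves three dependent
  rows, and a strict middle step yields a ribbon.\<close>

lemma dep_unique:
  assumes f: "five a b k l m" and C: "quads_dep C" and nc: "\<not> coplanar C"
    and x: "dep C a x" and y: "dep C a y"
  shows "y b - x b = y k - x k \<and> y b - x b = y l - x l \<and> y b - x b = y m - x m"
proof -
  define g where "g i = y i - x i" for i
  obtain b' k' l' m' where s: "{b', k', l', m'} = {b, k, l, m}" "g b' \<le> g k'" "g k' \<le> g l'" "g l' \<le> g m'"
    by (rule sort4)
  have f': "five a b' k' l' m'" using f s(1) unfolding five_def by (metis insert_commute)
  then have f2: "five k' l' m' a b'" "five b' k' l' a m'" "five b' k' l' m' a" unfolding five_def by auto
  have tx: "tie4 (x b' + v b') (x k' + v k') (x l' + v l') (x m' + v m')" if "v \<in> C" for v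
    using x that unfolding dep_iff[OF f'] by blast
  have ty: "tie4 (g b' + (x b' + v b')) (g k' + (x k' + v k')) (g l' + (x l' + v l')) (g m' + (x m' + v m'))" if "v \<in> C" for v
    using y that unfolding dep_iff[OF f'] g_def by (simp add: algebra_simps)
  have 1: "\<not> g b' < g k'"
  proof
    assume "g b' < g k'"
    then have "tie3 (x k' + v k') (x l' + v l') (x m' + v m')" if "v \<in> C" for v
      using tie4_drop_slowest[OF tx[OF that] ty[OF that]] s by auto
    from triple_coplanar[OF f2(1) C this] nc show False by blast
  qed
  have 2: "\<not> g l' < g m'"
  proof
    assume "g l' < g m'"
    then have "tie3 (y b' + v b') (y k' + v k') (y l' + v l')" if "v \<in> C" for v
      using tie4_drop_fastest[OF tx[OF that] ty[OF that]] s by (auto simp: g_def)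
    from triple_coplanar[OF f2(2) C this] nc show False by blast
  qed
  have 3: "\<not> g k' < g l'"
  proof
    assume lt: "g k' < g l'"
    have "coplanar (shift x C)"
    proof (rule ribbon_coplanar0[OF f2(3) quads_dep_shift[OF C], of 0 "g l' - g k'"])
      fix u assume "u \<in> shift x C"
      then obtain v where v: "v \<in> C" "u = (\<lambda>i. x i + v i)" unfolding shift_def by blast
      show "tie4 (u b') (u k') (0 + u l') (0 + u m')" using tx[OF v(1)] v(2) by simp
      show "tie4 (u b') (u k') (g l' - g k' + u l') (g l' - g k' + u m')"
        using ty[OF v(1)] 1 2 s(2-4) unfolding v(2) tie4_def by argo
    qed (use lt in simp)
    with coplanar_shift nc show False by blast
  qed
  have "g b' = g k'" "g k' = g l'" "g l' = g m'" using 1 2 3 s by auto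
  then have *: "g i = g b'" if "i \<in> {b, k, l, m}" for i using that unfolding s(1)[symmetric] by auto
  have "g b = g b'" "g k = g b'" "g l = g b'" "g m = g b'" by (rule *; simp)+
  then show ?thesis unfolding g_def by linarith
qed

section \<open>Segments with two coinciding break points\<close>

text \<open>Dependencies for the rows other than 1 and other than 2, normalised to \<open>(*, 0, 0, 0, 0)\<close> and
  \<open>(0, *, \<mu>, 0, 0)\<close>: the segment joining them breaks at 4 and 5 simultaneously.\<close>

definition cherry :: "real \<Rightarrow> real \<Rightarrow> real \<Rightarrow> real \<Rightarrow> real \<Rightarrow> real \<Rightarrow> bool" where
  "cherry \<mu> c1 c2 c3 c4 c5 \<longleftrightarrow> 0 < \<mu> \<and> tie4 c2 c3 c4 c5 \<and> tie4 c1 (\<mu> + c3) c4 c5"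

text \<open>Elimination of \<open>c3\<close>, unambiguous since \<open>\<mu>\<close> is positive. It
  makes the roles of 2 and 3 symmetric.\<close>

lemma cherry_third:
  assumes "cherry \<mu> c1 c2 c3 c4 c5"
  shows "tie4 c1 (\<mu> + c2) c4 c5"
  using assms unfolding tie4_def cherry_def by argo

text \<open>The leaves 4 and 5 run together along an edge of length \<open>\<theta>\<close>. Only
  columns with \<open>c4 = c5\<close> restrict this length; for them the alternatives amount to
  \<open>tie4 (\<theta> + c4) c1 c2 c3\<close>.\<close>

lemma plane_of_cherry:
  assumes "cherry \<mu> c1 c2 c3 c4 c5" "0 \<le> \<theta>"
    "c4 \<noteq> c5 \<or> (tie3 c1 c2 c3 \<and> (c1 \<le> \<theta> + c4 \<or> c2 \<le> \<theta> + c4 \<or> c3 \<le> \<theta> + c4)) \<or>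
     (\<theta> + c4 \<le> c1 \<and> \<theta> + c4 \<le> c2 \<and> \<theta> + c4 \<le> c3 \<and> (c1 = \<theta> + c4 \<or> c2 = \<theta> + c4 \<or> c3 = \<theta> + c4))"
  shows "plane \<mu> \<theta> c2 c3 c1 c4 c5"
  using assms unfolding tie4_def tie3_def cherry_def plane_def by argo

lemma cherry_low:
  assumes "cherry \<mu> c1 c2 c3 c4 c5" "c4 = c5" "\<not> tie3 c1 c2 c3"
  shows "c4 \<le> c1 \<and> c4 \<le> c2 \<and> c4 \<le> c3"
  using assms unfolding tie4_def tie3_def cherry_def by argo

text \<open>From the break point, one can move by \<open>m\<close> in the direction of the leaves 4 and 5.\<close>

definition cherry_free :: "real \<Rightarrow> real \<Rightarrow> real \<Rightarrow> real \<Rightarrow> real \<Rightarrow> real \<Rightarrow> bool" where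
  "cherry_free m c1 c2 c3 c4 c5 \<longleftrightarrow>
     c4 \<noteq> c5 \<or> tie3 c1 c2 c3 \<or> (m + c4 \<le> c1 \<and> m + c4 \<le> c2 \<and> m + c4 \<le> c3)"

text \<open>In the next three lemmas \<open>p\<close> is a dependency of the rows 1, 2, 3, 5, and the conclusions are
  new dependencies of the rows that occur in them.\<close>

lemma cherry_new_dep:
  assumes "cherry \<mu> c1 c2 c3 c4 c5" "cherry_free m c1 c2 c3 c4 c5" "0 < m"
    "tie4 (p1 + c1) (p2 + c2) (p3 + c3) (p5 + c5)" "m < p5"
  shows "p2 = 0 \<Longrightarrow> p3 = 0 \<Longrightarrow> 0 < p1 \<Longrightarrow> tie4 c2 c3 (m + c4) (m + c5)"
    "p1 = 0 \<Longrightarrow> p3 = 0 \<Longrightarrow> 0 < p2 \<Longrightarrow> tie4 c1 c3 (m + c4) (m + c5)"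
    "p1 = 0 \<Longrightarrow> p2 = 0 \<Longrightarrow> 0 < p3 \<Longrightarrow> tie4 c1 c2 (m + c4) (m + c5)"
    "0 < e \<Longrightarrow> e \<le> m \<Longrightarrow> p1 = 0 \<Longrightarrow> e \<le> p2 \<Longrightarrow> e \<le> p3 \<Longrightarrow> tie4 (e + c2) (e + c3) (m + c4) (m + c5)"
    "0 < e \<Longrightarrow> e \<le> m \<Longrightarrow> p2 = 0 \<Longrightarrow> e \<le> p1 \<Longrightarrow> e \<le> p3 \<Longrightarrow> tie4 (e + c1) (e + c3) (m + c4) (m + c5)"
    "0 < e \<Longrightarrow> e \<le> m \<Longrightarrow> p3 = 0 \<Longrightarrow> e \<le> p1 \<Longrightarrow> e \<le> p2 \<Longrightarrow> tie4 (e + c1) (e + c2) (m + c4) (m + c5)"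
  using assms unfolding tie4_def tie3_def cherry_def cherry_free_def by argo+

lemma cherry_new_dep0:
  assumes "cherry \<mu> c1 c2 c3 c4 c5" "tie4 (p1 + c1) (p2 + c2) (p3 + c3) (p5 + c5)" "0 < p5"
  shows "0 \<le> p2 \<Longrightarrow> 0 \<le> p3 \<Longrightarrow> 0 < p1 \<Longrightarrow> p2 = 0 \<or> p3 = 0 \<Longrightarrow>
      tie4 (min p2 p1 + c2) (min p3 p1 + c3) (p1 + c4) (min p5 p1 + c5)"
    "0 \<le> p1 \<Longrightarrow> p3 = 0 \<Longrightarrow> 0 < p2 \<Longrightarrow> tie4 c1 c3 c4 c5"
    "0 \<le> p1 \<Longrightarrow> p2 = 0 \<Longrightarrow> 0 < p3 \<Longrightarrow> tie4 c1 c2 c4 c5"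
  using assms unfolding tie4_def cherry_def min_def by argo+

lemma cherry_new_dep1:
  assumes "cherry \<mu> c1 c2 c3 c4 c5" "tie4 (p1 + c1) (p2 + c2) (p3 + c3) (p5 + c5)" "p1 = 0"
    "0 < t" "t < s" "s \<le> \<mu>" "s \<le> p2" "s \<le> p3" "t \<le> p5"
  shows "tie4 (s + c2) (s + c3) (t + c4) (t + c5)"
  using assms unfolding tie4_def cherry_def by argo

text \<open>With \<open>p5 = m\<close> the last term would be a strict minimum.\<close>

lemma tie4_slack:
  assumes "tie4 (p1 + c1) (p2 + c2) (p3 + c3) (p5 + c5)" "c4 = c5"
    "m + c4 < c1" "m + c4 < c2" "m + c4 < c3" "0 \<le> p1" "0 \<le> p2" "0 \<le> p3" "m \<le> p5"
  shows "m < p5"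
  using assms unfolding tie4_def by argo

lemma cherry_coplanar0:
  assumes f: "five a b e k l" and C: "quads_dep C"
    and S: "\<And>v. v \<in> C \<Longrightarrow> cherry \<mu> (v a) (v b) (v e) (v k) (v l)" and \<mu>: "0 < \<mu>"
  shows "coplanar C"
proof (rule ccontr)
  assume nc: "\<not> coplanar C"
  have fin: "finite C" using C by (simp add: quads_dep_def)
  have fs: "five b a e k l" "five e a b k l" "five k a b e l" "five b e a k l" using f by (simp_all add: five_def insert_commute)
  have dist: "distinct [a, b, e, k, l]" by (rule five_distinct[OF f])
  \<comment> \<open>By uniqueness, every dependency omitting \<open>a\<close>, \<open>b\<close> or
    \<open>e\<close> has the differences of the known one. The dependencies constructed below
    violate this.\<close>
  have Xa: "xb = xe \<and> xb = xk \<and> xb = xl"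
    if "\<And>v. v \<in> C \<Longrightarrow> tie4 (xb + v b) (xe + v e) (xk + v k) (xl + v l)" for xb xe xk xl
  proof -
    define x where "x = (\<lambda>_. 0::real)(b := xb, e := xe, k := xk, l := xl)"
    have x: "x b = xb" "x e = xe" "x k = xk" "x l = xl" using dist by (auto simp: x_def)
    have "dep C a x" unfolding dep_iff[OF f] x using that by blast
    moreover have "dep C a (\<lambda>_. 0)" unfolding dep_iff[OF f] using S by (simp add: cherry_def)
    ultimately show ?thesis using dep_unique[OF f C nc] x by fastforce
  qed
  have Xb: "ye = \<mu> + ya"
    if "\<And>v. v \<in> C \<Longrightarrow> tie4 (ya + v a) (ye + v e) (yk + v k) (yl + v l)" for ya ye yk yl
  proof -
    define x where "x = (\<lambda>_. 0::real)(a := ya, e := ye, k := yk, l := yl)"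
    define y where "y = (\<lambda>_. 0::real)(e := \<mu>)"
    have x: "x a = ya" "x e = ye" "x k = yk" "x l = yl" "y a = 0" "y e = \<mu>" "y k = 0" "y l = 0" using dist by (auto simp: x_def y_def)
    have "dep C b x" unfolding dep_iff[OF fs(1)] x using that by blast
    moreover have "dep C b y" unfolding dep_iff[OF fs(1)] x using S by (simp add: cherry_def)
    ultimately show ?thesis using dep_unique[OF fs(1) C nc] x by fastforce
  qed
  have Xe: "zb = \<mu> + za"
    if "\<And>v. v \<in> C \<Longrightarrow> tie4 (za + v a) (zb + v b) (zk + v k) (zl + v l)" for za zb zk zl
  proof -
    define x where "x = (\<lambda>_. 0::real)(a := za, b := zb, k := zk, l := zl)"
    define y where "y = (\<lambda>_. 0::real)(b := \<mu>)"
    have x: "x a = za" "x b = zb" "x k = zk" "x l = zl" "y a = 0" "y b = \<mu>" "y k = 0" "y l = 0" using dist by (auto simp: x_def y_def)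
    have "dep C e x" unfolding dep_iff[OF fs(2)] x using that by blast
    moreover have "dep C e y" unfolding dep_iff[OF fs(2)] x using cherry_third[OF S] by simp
    ultimately show ?thesis using dep_unique[OF fs(2) C nc] x by fastforce
  qed
  have tree: "\<exists>v\<in>C. \<not> (v k \<noteq> v l \<or> (tie3 (v a) (v b) (v e) \<and> (v a \<le> \<theta> + v k \<or> v b \<le> \<theta> + v k \<or> v e \<le> \<theta> + v k)) \<or>
      (v a \<ge> \<theta> + v k \<and> v b \<ge> \<theta> + v k \<and> v e \<ge> \<theta> + v k \<and> (v a = \<theta> + v k \<or> v b = \<theta> + v k \<or> v e = \<theta> + v k)))"
    if \<theta>: "0 \<le> \<theta>" for \<theta>
  proof (rule ccontr)
    assume *: "\<not> ?thesis"
    have "coplanar C"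
    proof (rule coplanarI0[OF fs(4), of \<mu> \<theta>])
      show "plane \<mu> \<theta> (v b) (v e) (v a) (v k) (v l)" if v: "v \<in> C" for v
        by (rule plane_of_cherry[OF S[OF v] \<theta>]) (use * v in blast)
    qed (use \<mu> \<theta> in auto)
    with nc show False ..
  qed
  define T where "T = {v \<in> C. v k = v l \<and> \<not> tie3 (v a) (v b) (v e)}"
  define hgt where "hgt v = min (v a) (min (v b) (v e)) - v k" for v :: "nat \<Rightarrow> real"
  have Tne: "T \<noteq> {}"
  proof
    assume T: "T = {}"
    obtain K where K: "0 \<le> K" "\<And>v. v \<in> C \<Longrightarrow> v a - v k \<le> K"
      by (rule finite_bound[OF fin, of "\<lambda>v. v a - v k"]) blast
    obtain v where "v \<in> C" "\<not> (v k \<noteq> v l \<or> tie3 (v a) (v b) (v e) \<and> v a \<le> K + v k)"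
      using tree[OF K(1)] by blast
    then show False using K(2)[of v] T unfolding T_def by auto
  qed
  have Tfin: "finite T" using fin by (simp add: T_def)
  \<comment> \<open>The largest \<open>m\<close> for which all columns are
    \<open>cherry_free\<close>; the columns in \<open>T\<close> are those that limit it.\<close>
  define m where "m = Min (hgt ` T)"
  have "m \<in> hgt ` T" unfolding m_def using Tfin Tne by (intro Min_in) auto
  then obtain j where j: "j \<in> T" "m = hgt j" by blast
  have m: "m \<le> hgt v" if "v \<in> T" for v unfolding m_def using Tfin that by simp
  have jC: "j \<in> C" "j k = j l" "\<not> tie3 (j a) (j b) (j e)" using j by (auto simp: T_def)
  have m0: "0 \<le> m" using cherry_low[OF S[OF jC(1)] jC(2,3)] j(2) by (auto simp: hgt_def)
  have Um: "cherry_free m (v a) (v b) (v e) (v k) (v l)" if "v \<in> C" for v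
    using m[of v] that unfolding cherry_free_def T_def hgt_def by auto
  \<comment> \<open>The column \<open>j\<close> forces the two leaves to separate after length \<open>m\<close>, but \<open>i\<close> does not allow this.\<close>
  obtain i where i: "i \<in> C" "i k = i l" "m + i k < i a" "m + i k < i b" "m + i k < i e"
  proof -
    obtain v where v: "v \<in> C" "\<not> (v k \<noteq> v l \<or> (tie3 (v a) (v b) (v e) \<and> (v a \<le> m + v k \<or> v b \<le> m + v k \<or> v e \<le> m + v k)) \<or>
      (v a \<ge> m + v k \<and> v b \<ge> m + v k \<and> v e \<ge> m + v k \<and> (v a = m + v k \<or> v b = m + v k \<or> v e = m + v k)))"
      using tree[OF m0] by blast
    have "v k = v l \<and> m + v k < v a \<and> m + v k < v b \<and> m + v k < v e"
      using v(2) Um[OF v(1)] unfolding cherry_free_def by argo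
    with v(1) that show thesis by blast
  qed
  obtain w where w: "dep C k w" using C five_less[OF f] unfolding quads_dep_def by blast
  \<comment> \<open>Normalises \<open>w\<close> to be at least 0 at \<open>a\<close>,
    \<open>b\<close>, \<open>e\<close> and at least \<open>m\<close> at \<open>l\<close>, with
    equality somewhere.\<close>
  define M where "M = min (min (w a) (w b)) (min (w e) (w l - m))"
  define p where "p i = w i - M" for i
  have p: "tie4 (p a + v a) (p b + v b) (p e + v e) (p l + v l)" if "v \<in> C" for v
  proof -
    have "tie4 (w a + v a) (w b + v b) (w e + v e) (w l + v l)"
      using w that unfolding dep_iff[OF fs(3)] by blast
    then show ?thesis unfolding tie4_def p_def by argo
  qed
  have p0: "0 \<le> p a" "0 \<le> p b" "0 \<le> p e" "m \<le> p l" and pz: "p a = 0 \<or> p b = 0 \<or> p e = 0 \<or> p l = m"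
    by (auto simp: p_def M_def min_def)
  have pl: "m < p l" using tie4_slack[OF p[OF i(1)] i(2-5) p0] .
  note pj = p[OF jC(1)]
  \<comment> \<open>Among \<open>a\<close>, \<open>b\<close>, \<open>e\<close>, column
    \<open>j\<close> has a strict minimum of height \<open>m\<close>. If \<open>p\<close> vanished
    there, that row would be the strict minimum of all four terms.\<close>
  have r: "j a = m + j k \<and> 0 < p a \<or> j b = m + j k \<and> 0 < p b \<or> j e = m + j k \<and> 0 < p e"
  proof -
    have "(j a = m + j k \<and> j a < j b \<and> j a < j e) \<or> (j b = m + j k \<and> j b < j a \<and> j b < j e) \<or> (j e = m + j k \<and> j e < j a \<and> j e < j b)"
      using j(2) jC(3) unfolding hgt_def tie3_def by linarith
    then show ?thesis
      using pj jC(2) p0 pl unfolding tie4_def by argo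
  qed
  show False
  proof (cases "m = 0")
    case False
    then have m: "0 < m" using m0 by simp
    \<comment> \<open>Half of \<open>m\<close> keeps the new coefficient different from
      \<open>m\<close>, which is what contradicts \<open>Xa\<close>.\<close>
    define \<epsilon> where "\<epsilon> q q' = min (m / 2) (min (p q) (p q'))" for q q'
    have \<epsilon>: "\<epsilon> q q' < m" "\<epsilon> q q' \<le> p q" "\<epsilon> q q' \<le> p q'" "0 < p q \<Longrightarrow> 0 < p q' \<Longrightarrow> 0 < \<epsilon> q q'" for q q'
      using m by (auto simp: \<epsilon>_def)
    consider "p a = 0" "p b = 0" "0 < p e" | "p a = 0" "p e = 0" "0 < p b" | "p b = 0" "p e = 0" "0 < p a"
      | "p a = 0" "0 < p b" "0 < p e" | "p b = 0" "0 < p a" "0 < p e" | "p e = 0" "0 < p a" "0 < p b"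
      using r pz pl p0 by argo
    then show False
    proof cases
      case 1
      have "tie4 (0 + v a) (0 + v b) (m + v k) (m + v l)" if v: "v \<in> C" for v
        using cherry_new_dep(3)[OF S[OF v] Um[OF v] m p[OF v] pl] 1  by auto
      from Xe[OF this] show False using \<mu> by simp
    next
      case 2
      have "tie4 (0 + v a) (0 + v e) (m + v k) (m + v l)" if v: "v \<in> C" for v
        using cherry_new_dep(2)[OF S[OF v] Um[OF v] m p[OF v] pl] 2  by auto
      from Xb[OF this] show False using \<mu> by simp
    next
      case 3
      have "tie4 (0 + v b) (0 + v e) (m + v k) (m + v l)" if v: "v \<in> C" for v
        using cherry_new_dep(1)[OF S[OF v] Um[OF v] m p[OF v] pl] 3  by auto
      from Xa[OF this] show False using m by simp
    next
      case 4
      have "tie4 (\<epsilon> b e + v b) (\<epsilon> b e + v e) (m + v k) (m + v l)" if v: "v \<in> C" for v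
        using cherry_new_dep(4)[OF S[OF v] Um[OF v] m p[OF v] pl, of "\<epsilon> b e"] 4 \<epsilon>[of b e] by auto
      from Xa[OF this] show False using \<epsilon>[of b e] by simp
    next
      case 5
      have "tie4 (\<epsilon> a e + v a) (\<epsilon> a e + v e) (m + v k) (m + v l)" if v: "v \<in> C" for v
        using cherry_new_dep(5)[OF S[OF v] Um[OF v] m p[OF v] pl, of "\<epsilon> a e"] 5 \<epsilon>[of a e] by auto
      from Xb[OF this] show False using \<mu> by simp
    next
      case 6
      have "tie4 (\<epsilon> a b + v a) (\<epsilon> a b + v b) (m + v k) (m + v l)" if v: "v \<in> C" for v
        using cherry_new_dep(6)[OF S[OF v] Um[OF v] m p[OF v] pl, of "\<epsilon> a b"] 6 \<epsilon>[of a b] by auto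
      from Xe[OF this] show False using \<mu> by simp
    qed
  next
    case m: True
    then have pl': "0 < p l" using pl by simp
    consider "0 < p a" "p b = 0 \<or> p e = 0" | "p e = 0" "0 < p b" | "p b = 0" "0 < p e" | "p a = 0" "0 < p b" "0 < p e"
      using r pz pl p0 m by argo
    then show False
    proof cases
      case 1
      have "tie4 (min (p b) (p a) + v b) (min (p e) (p a) + v e) (p a + v k) (min (p l) (p a) + v l)" if v: "v \<in> C" for v
        using cherry_new_dep0(1)[OF S[OF v] p[OF v] pl'] 1 p0 by auto
      from Xa[OF this] show False using 1 by (auto simp: min_def split: if_splits)
    next
      case 2
      have "tie4 (0 + v a) (0 + v e) (0 + v k) (0 + v l)" if v: "v \<in> C" for v
        using cherry_new_dep0(2)[OF S[OF v] p[OF v] pl'] 2 p0 by auto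
      from Xb[OF this] show False using \<mu> by simp
    next
      case 3
      have "tie4 (0 + v a) (0 + v b) (0 + v k) (0 + v l)" if v: "v \<in> C" for v
        using cherry_new_dep0(3)[OF S[OF v] p[OF v] pl'] 3 p0 by auto
      from Xe[OF this] show False using \<mu> by simp
    next
      case 4
      define s where "s = min (min \<mu> (p b)) (min (p e) (p l))"
      have s: "0 < s" "s \<le> \<mu>" "s \<le> p b" "s \<le> p e" "s / 2 \<le> p l" "s / 2 < s" "0 < s / 2"
        using 4 \<mu> pl' by (auto simp: s_def min_def)
      have "tie4 (s + v b) (s + v e) (s / 2 + v k) (s / 2 + v l)" if v: "v \<in> C" for v
        by (rule cherry_new_dep1[OF S[OF v] p[OF v] 4(1) s(7,6,2,3,4,5)])
      from Xa[OF this] show False using s by simp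
    qed
  qed
qed

lemma cherry_coplanar:
  assumes f: "five a b e k l" and C: "quads_dep C" and x: "dep C a x" and y: "dep C b y"
    and eq: "y k - x k = y l - x l" and lt: "y k - x k < y e - x e"
  shows "coplanar C"
proof -
  \<comment> \<open>The point of the segment at which the leaves \<open>k\<close> and
    \<open>l\<close> are attached together.\<close>
  define p where "p = x(a := y a - (y k - x k))"
  define \<mu> where "\<mu> = (y e - x e) - (y k - x k)"
  have p: "p a = y a - (y k - x k)" "p b = x b" "p e = x e" "p k = x k" "p l = x l"
    using five_distinct[OF f] by (auto simp: p_def)
  have f': "five b a e k l" using f by (simp_all add: five_def insert_commute)
  have "coplanar (shift p C)"
  proof (rule cherry_coplanar0[OF f quads_dep_shift[OF C]])
    show "0 < \<mu>" using lt by (simp add: \<mu>_def)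
    fix u assume "u \<in> shift p C"
    then obtain v where v: "v \<in> C" "u = (\<lambda>i. p i + v i)" unfolding shift_def by blast
    have "tie4 (x b + v b) (x e + v e) (x k + v k) (x l + v l)" "tie4 (y a + v a) (y e + v e) (y k + v k) (y l + v l)"
      using x y v(1) unfolding dep_iff[OF f] dep_iff[OF f'] by blast+
    then show "cherry \<mu> (u a) (u b) (u e) (u k) (u l)"
      using lt eq unfolding cherry_def v(2) p \<mu>_def tie4_def by argo
  qed
  then show ?thesis by (rule coplanar_shift)
qed

section \<open>Combining the cases\<close>

lemma dep_shift_const:
  assumes "dep C a x" "\<And>i. i < 5 \<Longrightarrow> i \<noteq> a \<Longrightarrow> x i = p i + t"
  shows "dep C a p"
proof -
  have "ties ({..<5} - {a}) (\<lambda>i. p i + v i)" if "v \<in> C" for v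
    unfolding ties_def
  proof
    fix i assume i: "i \<in> {..<5} - {a}"
    then obtain j where j: "j \<in> {..<5} - {a}" "j \<noteq> i" "x j + v j \<le> x i + v i"
      using assms(1) \<open>v \<in> C\<close> unfolding dep_def ties_def by blast
    have "x i = p i + t" "x j = p j + t" using i j(1) assms(2) by auto
    with j show "\<exists>j\<in>{..<5} - {a}. j \<noteq> i \<and> p j + v j \<le> p i + v i" by (intro bexI[of _ j]) auto
  qed
  then show ?thesis by (simp add: dep_def)
qed

theorem quads_dep_coplanar:
  assumes C: "quads_dep C"
  shows "coplanar C"
proof (rule ccontr)
  assume nc: "\<not> coplanar C"
  have "\<forall>a. \<exists>x. a < 5 \<longrightarrow> dep C a x" using C unfolding quads_dep_def by blast
  then obtain W where W: "\<And>a. a < 5 \<Longrightarrow> dep C a (W a)" by metis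
  \<comment> \<open>If the third break point differed, the segment would be a cherry when read from
    \<open>a\<close> to \<open>b\<close> or from \<open>b\<close> to \<open>a\<close>, according to
    the order of the break points.\<close>
  have two: "W b e - W a e = W b k - W a k" if f: "five a b e k l" and eq: "W b k - W a k = W b l - W a l" for a b e k l
  proof (rule ccontr)
    assume ne: "\<not> ?thesis"
    have f': "five b a e k l" using f by (simp_all add: five_def insert_commute)
    have lt: "a < 5" "b < 5" using five_less[OF f] by auto
    show False
    proof (cases "W b k - W a k < W b e - W a e")
      case True
      then show False using cherry_coplanar[OF f C W W] lt eq nc by blast
    next
      case False
      then have "W a k - W b k < W a e - W b e" "W a k - W b k = W a l - W b l" using ne eq by auto
      then show False using cherry_coplanar[OF f' C W W] lt nc by blast
    qed
  qed
  have three: "W b k - W a k = W b l - W a l" if f: "five a b k l m" for a b k l m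
  proof -
    have fs: "five a b m k l" "five a b l k m" "five a b k l m" using f by (simp_all add: five_def insert_commute)
    have "a < 5" "b < 5" using five_less[OF f] by auto
    then have "W b k - W a k = W b l - W a l \<or> W b k - W a k = W b m - W a m \<or> W b l - W a l = W b m - W a m"
      using generic_pair_coplanar[OF f W W] nc by blast
    then show ?thesis using two[OF fs(1)] two[OF fs(2)] two[OF fs(3)] by argo
  qed
  have three': "W b k - W a k = W b l - W a l"
    if "a < 5" "b < 5" "k < 5" "l < 5" "distinct [a, b, k, l]" for a b k l
  proof -
    have "card ({..<5} - set [a, b, k, l]) = 1"
      using that by (subst card_Diff_subset) auto
    then obtain m where m: "{..<5} - set [a, b, k, l] = {m}" by (auto simp: card_1_singleton_iff)
    have "five a b k l m" unfolding five_def using m that by auto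
    then show ?thesis by (rule three)
  qed
  \<comment> \<open>The candidate for the centre of a star: \<open>W 0\<close>, with its entry at 0
    taken from \<open>W 1\<close> after aligning the two at row 2.\<close>
  define p where "p = (W 0)(0 := W 1 0 - (W 1 2 - W 0 2))"
  have f: "five 0 1 2 3 4" "five 1 0 2 3 4" "five 2 0 1 3 4" "five 3 0 1 2 4" "five 4 0 1 2 3"
    unfolding five_def by auto
  have dp: "dep C a p" if a: "a < 5" for a
  proof (cases "a = 0")
    case True
    then show ?thesis by (intro dep_shift_const[OF W[OF a], of p 0]) (auto simp: p_def)
  next
    case a0: False
    have "\<exists>t. \<forall>i<5. i \<noteq> a \<longrightarrow> W a i = p i + t"
    proof (cases "a = 1")
      case True
      have "W 1 i = p i + (W 1 2 - W 0 2)" if "i < 5" "i \<noteq> 1" for i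
        using three'[of 0 1 i 2] that by (cases "i = 0 \<or> i = 2") (auto simp: p_def)
      then show ?thesis using True by blast
    next
      case False
      \<comment> \<open>A row different from 0, 1 and \<open>a\<close>, at which \<open>W a\<close>
        can be compared with both \<open>W 0\<close> and \<open>W 1\<close>.\<close>
      define j where "j = (if a = 2 then 3 else 2 :: nat)"
      have j: "j < 5" "j \<noteq> 0" "j \<noteq> 1" "j \<noteq> a" by (auto simp: j_def)
      have "W a i = p i + (W a j - W 0 j)" if i: "i < 5" "i \<noteq> a" for i
      proof (cases "i = 0")
        case True
        have "W a 0 - W 1 0 = W a j - W 1 j" using three'[of 1 a 0 j] a a0 False j by auto
        moreover have "W 1 2 - W 0 2 = W 1 j - W 0 j" using three'[of 0 1 2 j] j by (cases "j = 2") auto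
        ultimately show ?thesis using True by (simp add: p_def)
      next
        case i0: False
        then show ?thesis using three'[of 0 a i j] i a a0 j by (cases "i = j") (auto simp: p_def)
      qed
      then show ?thesis by blast
    qed
    then obtain t where "\<forall>i<5. i \<noteq> a \<longrightarrow> W a i = p i + t" ..
    then show ?thesis using dep_shift_const[OF W[OF a], of p t] by blast
  qed
  have "coplanar C"
  proof (rule coplanarI[OF f(1), of 0 0 _ p])
    fix v assume v: "v \<in> C"
    have "tie4 (p 1 + v 1) (p 2 + v 2) (p 3 + v 3) (p 4 + v 4)" "tie4 (p 0 + v 0) (p 2 + v 2) (p 3 + v 3) (p 4 + v 4)"
      "tie4 (p 0 + v 0) (p 1 + v 1) (p 3 + v 3) (p 4 + v 4)" "tie4 (p 0 + v 0) (p 1 + v 1) (p 2 + v 2) (p 4 + v 4)"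
      "tie4 (p 0 + v 0) (p 1 + v 1) (p 2 + v 2) (p 3 + v 3)"
      using dp[of 0] dp[of 1] dp[of 2] dp[of 3] dp[of 4] v
      unfolding dep_iff[OF f(1)] dep_iff[OF f(2)] dep_iff[OF f(3)] dep_iff[OF f(4)] dep_iff[OF f(5)] by auto
    then show "plane 0 0 (p 0 + v 0) (p 1 + v 1) (p 2 + v 2) (p 3 + v 3) (p 4 + v 4)"
      unfolding plane_def tie4_def by argo
  qed auto
  with nc show False ..
qed

section \<open>Tropical dependence of four rows\<close>

text \<open>A fixed point of the map \<open>F\<close> in the proof makes all four total slacks equal; if they vanish, the
  hyperplanes meet, and if they are positive, each row is the strict minimum of some column.\<close>

lemma tie4_alternative:
  fixes r1 r2 r3 r4 :: "'c \<Rightarrow> real"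
  assumes C: "finite C"
  obtains (tied) x y z where "\<And>v. v \<in> C \<Longrightarrow> tie4 (x + r1 v) (y + r2 v) (z + r3 v) (r4 v)"
  | (untied) x y z v1 v2 v3 v4 where "v1 \<in> C" "v2 \<in> C" "v3 \<in> C" "v4 \<in> C"
     "x + r1 v1 < y + r2 v1" "x + r1 v1 < z + r3 v1" "x + r1 v1 < r4 v1"
     "y + r2 v2 < x + r1 v2" "y + r2 v2 < z + r3 v2" "y + r2 v2 < r4 v2"
     "z + r3 v3 < x + r1 v3" "z + r3 v3 < y + r2 v3" "z + r3 v3 < r4 v3"
     "r4 v4 < x + r1 v4" "r4 v4 < y + r2 v4" "r4 v4 < z + r3 v4"
proof -
  define g where "g p q s t = max 0 (min q (min s t) - p)" for p q s t :: real
  define h1 where "h1 w = (\<Sum>v\<in>C. g (fst w + r1 v) (fst (snd w) + r2 v) (snd (snd w) + r3 v) (r4 v))" for w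
  define h2 where "h2 w = (\<Sum>v\<in>C. g (fst (snd w) + r2 v) (fst w + r1 v) (snd (snd w) + r3 v) (r4 v))" for w
  define h3 where "h3 w = (\<Sum>v\<in>C. g (snd (snd w) + r3 v) (fst w + r1 v) (fst (snd w) + r2 v) (r4 v))" for w
  define h4 where "h4 w = (\<Sum>v\<in>C. g (r4 v) (fst w + r1 v) (fst (snd w) + r2 v) (snd (snd w) + r3 v))" for w
  note h_defs = h1_def h2_def h3_def h4_def
  \<comment> \<open>If row 1 lies strictly below row 4 in some column then \<open>x < K\<close>, and
    if strictly above then \<open>- K < x\<close>; likewise for rows 2 and 3. Hence clipping to the
    box creates no spurious fixed points.\<close>
  define K where "K = 1 + (\<Sum>v\<in>C. \<bar>r1 v\<bar> + \<bar>r2 v\<bar> + \<bar>r3 v\<bar> + \<bar>r4 v\<bar>)"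
  have K: "\<bar>r1 v\<bar> + \<bar>r2 v\<bar> + \<bar>r3 v\<bar> + \<bar>r4 v\<bar> < K" if "v \<in> C" for v
    using member_le_sum[OF that _ C, of "\<lambda>v. \<bar>r1 v\<bar> + \<bar>r2 v\<bar> + \<bar>r3 v\<bar> + \<bar>r4 v\<bar>"] unfolding K_def by simp
  have K0: "0 < K" unfolding K_def by (smt (verit) abs_ge_zero sum_nonneg)
  define cl where "cl t = max (- K) (min K t)" for t
  \<comment> \<open>Each coefficient grows by the total slack with which its row is a strict
    minimum, relative to the fourth row.\<close>
  define F where "F w = (cl (fst w + h1 w - h4 w), cl (fst (snd w) + h2 w - h4 w), cl (snd (snd w) + h3 w - h4 w))" for w
  define S where "S = {-K..K} \<times> ({-K..K} \<times> {-K..K})"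
  have "compact S" "convex S" unfolding S_def by (intro compact_Times convex_Times compact_Icc convex_real_interval)+
  moreover have "S \<noteq> {}" using K0 by (simp add: S_def)
  moreover have "continuous_on S F"
    unfolding F_def cl_def h_defs g_def by (intro continuous_intros)
  moreover have "F \<in> S \<rightarrow> S" using K0 by (auto simp: F_def S_def cl_def)
  ultimately obtain w where w: "w \<in> S" "F w = w" by (rule brouwer)
  obtain x y z where xyz: "w = (x, y, z)" by (metis prod.exhaust)
  have fp: "cl (x + h1 w - h4 w) = x" "cl (y + h2 w - h4 w) = y" "cl (z + h3 w - h4 w) = z"
    using w(2) by (auto simp: F_def xyz)
  have g0: "0 \<le> g p q s t" "0 < g p q s t \<longleftrightarrow> p < q \<and> p < s \<and> p < t" for p q s t by (auto simp: g_def)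
  have pos: "0 < (\<Sum>v\<in>C. g (p v) (q v) (s v) (t v)) \<longleftrightarrow> (\<exists>v\<in>C. p v < q v \<and> p v < s v \<and> p v < t v)" for p q s t
    unfolding g0(2)[symmetric] using sum_nonneg_eq_0_iff[OF C, of "\<lambda>v. g (p v) (q v) (s v) (t v)"] g0(1)
      sum_nonneg[of C "\<lambda>v. g (p v) (q v) (s v) (t v)"] by (smt (verit))
  have p1: "0 < h1 w \<longleftrightarrow> (\<exists>v\<in>C. x + r1 v < y + r2 v \<and> x + r1 v < z + r3 v \<and> x + r1 v < r4 v)"
   and p2: "0 < h2 w \<longleftrightarrow> (\<exists>v\<in>C. y + r2 v < x + r1 v \<and> y + r2 v < z + r3 v \<and> y + r2 v < r4 v)"
   and p3: "0 < h3 w \<longleftrightarrow> (\<exists>v\<in>C. z + r3 v < x + r1 v \<and> z + r3 v < y + r2 v \<and> z + r3 v < r4 v)"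
   and p4: "0 < h4 w \<longleftrightarrow> (\<exists>v\<in>C. r4 v < x + r1 v \<and> r4 v < y + r2 v \<and> r4 v < z + r3 v)"
    unfolding h_defs pos xyz by simp_all
  have nn: "0 \<le> h1 w" "0 \<le> h2 w" "0 \<le> h3 w" "0 \<le> h4 w" unfolding h_defs by (intro sum_nonneg g0)+
  have eq: "h = h4 w" if fx: "cl (u + h - h4 w) = u" and h: "0 \<le> h" "0 < h \<Longrightarrow> u < K" "0 < h4 w \<Longrightarrow> - K < u" for h u
    using fx h nn(4) K0 unfolding cl_def max_def min_def by (smt (verit))
  have "h1 w = h4 w" by (rule eq[OF fp(1) nn(1)]) (use p1 p4 K in fastforce)+
  moreover have "h2 w = h4 w" by (rule eq[OF fp(2) nn(2)]) (use p2 p4 K in fastforce)+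
  moreover have "h3 w = h4 w" by (rule eq[OF fp(3) nn(3)]) (use p3 p4 K in fastforce)+
  ultimately have heq: "0 < h1 w \<longleftrightarrow> 0 < h4 w" "0 < h2 w \<longleftrightarrow> 0 < h4 w" "0 < h3 w \<longleftrightarrow> 0 < h4 w" by auto
  show thesis
  proof (cases "0 < h4 w")
    case True
    then show thesis using untied heq unfolding p1 p2 p3 p4 by metis
  next
    case False
    have "tie4 (x + r1 v) (y + r2 v) (z + r3 v) (r4 v)" if "v \<in> C" for v
      using False heq that unfolding p1 p2 p3 p4 tie4_def by (meson not_le)
    then show thesis by (rule tied)
  qed
qed

section \<open>Lifting to Hahn series\<close>

lemma hcoeff_less_hdeg: "a \<noteq> 0 \<Longrightarrow> e < hdeg a \<Longrightarrow> hcoeff (a :: 'a::comm_ring_1 hahn) e = 0"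
  using hdeg_in_hsupp(2)[of a e] by (force simp: hsupp_def)

lemma hcoeff_hdeg: "a \<noteq> 0 \<Longrightarrow> hcoeff (a :: 'a::comm_ring_1 hahn) (hdeg a) \<noteq> 0"
  using hdeg_in_hsupp(1)[of a] by (simp add: hsupp_def)

lemma hdeg_eqI:
  fixes a :: "'a::comm_ring_1 hahn"
  assumes "hcoeff a d \<noteq> 0" "\<And>e. e < d \<Longrightarrow> hcoeff a e = 0"
  shows "a \<noteq> 0" "hdeg a = d"
proof -
  show "a \<noteq> 0" using assms(1) by auto
  show "hdeg a = d" unfolding hdeg_def
    by (rule Least_equality) (use assms in \<open>force simp: hsupp_def\<close>)+
qed

lemma hdeg_uminus: "hdeg (- a :: 'a::comm_ring_1 hahn) = hdeg a"
  by (simp add: hdeg_def hsupp_def)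

context
  fixes y1 y2 :: "nat \<Rightarrow> 'f::field hahn"
begin

text \<open>The Pluecker coordinates of the span of \<open>y1\<close> and \<open>y2\<close>. The
  columns are lifted to its orthogonal complement, whose circuits have brackets as entries.\<close>

definition bracket :: "nat \<Rightarrow> nat \<Rightarrow> 'f hahn" where
  "bracket i j = y1 i * y2 j - y1 j * y2 i"

definition in_kernel :: "(nat \<Rightarrow> 'f hahn) \<Rightarrow> bool" where
  "in_kernel z \<longleftrightarrow> (\<Sum>i<5. z i * y1 i) = 0 \<and> (\<Sum>i<5. z i * y2 i) = 0"

lemma bracket_commute: "bracket i j = - bracket j i"
  by (simp add: bracket_def)

lemma in_kernel_add_mult:
  assumes "in_kernel z" "in_kernel w"
  shows "in_kernel (\<lambda>i. z i + c * w i)"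
proof -
  have "(\<Sum>i<5. (z i + c * w i) * y i) = (\<Sum>i<5. z i * y i) + c * (\<Sum>i<5. w i * y i)" for y
    by (simp add: distrib_right sum.distrib sum_distrib_left mult.assoc)
  then show ?thesis using assms by (simp add: in_kernel_def)
qed

text \<open>By the three-term Pluecker relation.\<close>

lemma circuit_in_kernel:
  assumes d: "distinct [i, j, k]" "i < 5" "j < 5" "k < 5"
  shows "in_kernel (\<lambda>n. if n = i then c * bracket j k else if n = j then c * bracket k i else if n = k then c * bracket i j else 0)"
    (is "in_kernel ?z")
proof -
  have s: "(\<Sum>n<5. ?z n * y n) = c * (bracket j k * y i + bracket k i * y j + bracket i j * y k)" for y
  proof -
    have "(\<Sum>n<5. ?z n * y n) = (\<Sum>n\<in>{i, j, k}. ?z n * y n)"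
      by (rule sum.mono_neutral_right) (use d in auto)
    also have "\<dots> = c * (bracket j k * y i + bracket k i * y j + bracket i j * y k)"
      using d by (simp add: algebra_simps)
    finally show ?thesis .
  qed
  show ?thesis unfolding in_kernel_def s by (simp add: bracket_def algebra_simps)
qed

lemma avoid_three:
  fixes u v w :: 'f
  assumes "infinite (UNIV :: 'f set) \<or> card (UNIV :: 'f set) \<ge> 4"
  obtains c where "c \<noteq> u" "c \<noteq> v" "c \<noteq> w"
proof -
  have "{u, v, w} \<noteq> UNIV"
  proof
    assume U: "{u, v, w} = UNIV"
    have "card {u, v, w} \<le> 3" by (simp add: card_insert_if)
    moreover have "finite (UNIV :: 'f set)" by (simp add: U[symmetric])
    ultimately show False using assms by (simp add: U)
  qed
  then show ?thesis using that by blast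
qed

text \<open>The pair \<open>j, k\<close> minimises \<open>D\<close> among the pairs avoiding
  \<open>i\<close>. By the tie conditions for \<open>j\<close> and \<open>k\<close>, exchanging one
  of them for \<open>i\<close> gives no smaller value, so the circuit on \<open>i, j, k\<close>,
  scaled to degree \<open>x i\<close> at \<open>i\<close>, respects all the bounds.\<close>

lemma circuit_exists:
  assumes br: "\<forall>i<5. \<forall>j<5. i \<noteq> j \<longrightarrow> bracket i j \<noteq> 0"
    and tie: "\<forall>k<5. \<forall>i<5. i \<noteq> k \<longrightarrow> (\<exists>j<5. j \<noteq> i \<and> j \<noteq> k \<and> hdeg (bracket j k) + x j \<le> hdeg (bracket i k) + x i)"
    and i: "i < 5"
  obtains z j k where "in_kernel z" "\<And>n e. e < x n \<Longrightarrow> hcoeff (z n) e = 0" "hcoeff (z i) (x i) \<noteq> 0"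
    "\<And>n. n \<noteq> i \<Longrightarrow> n \<noteq> j \<Longrightarrow> n \<noteq> k \<Longrightarrow> z n = 0" 
proof -
  have sym: "hdeg (bracket j k) = hdeg (bracket k j)" for j k by (subst bracket_commute) (rule hdeg_uminus)
  define D where "D p = hdeg (bracket (fst p) (snd p)) + x (fst p) + x (snd p)" for p
  define P where "P = {p. fst p < 5 \<and> snd p < 5 \<and> fst p \<noteq> i \<and> snd p \<noteq> i \<and> fst p \<noteq> snd p}"
  have "finite P" by (rule finite_subset[of _ "{..<5} \<times> {..<5}"]) (auto simp: P_def)
  moreover have "P \<noteq> {}"
  proof -
    have "((if i = 0 then 1 else 0), (if i = 2 then 3 else 2)) \<in> P \<or> (0,1) \<in> P" using i by (auto simp: P_def)
    then show ?thesis by blast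
  qed
  ultimately obtain q where q: "q \<in> P" "\<And>p. p \<in> P \<Longrightarrow> D q \<le> D p" using ex_min_if_finite[of "D ` P"] 
    by (metis (no_types, lifting) arg_min_if_finite(1) arg_min_least)
  obtain j k where jk: "q = (j, k)" by fastforce
  have d: "j < 5" "k < 5" "distinct [i, j, k]" using q(1) by (auto simp: P_def jk)
  have ik: "D q \<le> hdeg (bracket i k) + x i + x k"
  proof -
    obtain j' where "j' < 5" "j' \<noteq> i" "j' \<noteq> k" "hdeg (bracket j' k) + x j' \<le> hdeg (bracket i k) + x i"
      using tie d i by (metis distinct_length_2_or_more)
    then show ?thesis using q(2)[of "(j', k)"] d by (auto simp: P_def D_def)
  qed
  have ij: "D q \<le> hdeg (bracket i j) + x i + x j"
  proof -
    obtain k' where "k' < 5" "k' \<noteq> i" "k' \<noteq> j" "hdeg (bracket k' j) + x k' \<le> hdeg (bracket i j) + x i"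
      using tie d i by (metis distinct_length_2_or_more)
    then show ?thesis using q(2)[of "(k', j)"] d by (auto simp: P_def D_def)
  qed
  define c where "c = hmonom (x i - hdeg (bracket j k)) (1 :: 'f)"
  define z where "z n = (if n = i then c * bracket j k else if n = j then c * bracket k i else if n = k then c * bracket i j else 0)" for n
  have b: "bracket j k \<noteq> 0" "bracket k i \<noteq> 0" "bracket i j \<noteq> 0" using br d i by auto
  have co: "hcoeff (c * a) e = hcoeff a (e - x i + hdeg (bracket j k))" for a e
    unfolding c_def hcoeff_hmonom_times by (simp add: algebra_simps)
  show thesis
  proof (rule that)
    show "in_kernel z" unfolding z_def using circuit_in_kernel d i by blast
    show "hcoeff (z n) e = 0" if "e < x n" for n e
      unfolding z_def using that ij ik b d sym[of i k] by (auto simp: co D_def jk intro!: hcoeff_less_hdeg)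
    show "hcoeff (z i) (x i) \<noteq> 0" using hcoeff_hdeg[OF b(1)] by (simp add: z_def co)
    show "z n = 0" if "n \<noteq> i" "n \<noteq> j" "n \<noteq> k" for n using that by (simp add: z_def)
  qed
qed

lemma kernel_lift:
  assumes F: "infinite (UNIV :: 'f set) \<or> card (UNIV :: 'f set) \<ge> 4"
    and br: "\<forall>i<5. \<forall>j<5. i \<noteq> j \<longrightarrow> bracket i j \<noteq> 0"
    and tie: "\<forall>k<5. \<forall>i<5. i \<noteq> k \<longrightarrow> (\<exists>j<5. j \<noteq> i \<and> j \<noteq> k \<and> hdeg (bracket j k) + x j \<le> hdeg (bracket i k) + x i)"
  obtains z where "in_kernel z" "\<And>i. i < 5 \<Longrightarrow> z i \<noteq> 0" "\<And>i. i < 5 \<Longrightarrow> hdeg (z i) = x i"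
proof -
  \<comment> \<open>The bounds are stated through coefficients because the coordinates not yet
    treated may vanish.\<close>
  have "m \<le> 5 \<Longrightarrow> \<exists>z. in_kernel z \<and> (\<forall>n e. e < x n \<longrightarrow> hcoeff (z n) e = 0) \<and> (\<forall>n<m. hcoeff (z n) (x n) \<noteq> 0)" for m
  proof (induction m)
    case 0
    show ?case by (rule exI[of _ "\<lambda>_. 0"]) (simp add: in_kernel_def)
  next
    case (Suc m)
    then obtain z where z: "in_kernel z" "\<And>n e. e < x n \<Longrightarrow> hcoeff (z n) e = 0" "\<And>n. n < m \<Longrightarrow> hcoeff (z n) (x n) \<noteq> 0"
      by auto
    show ?case
    proof (cases "hcoeff (z m) (x m) = 0")
      case False
      then show ?thesis using z by (intro exI[of _ z]) (auto simp: less_Suc_eq)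
    next
      case True
      obtain w j k where w: "in_kernel w" "\<And>n e. e < x n \<Longrightarrow> hcoeff (w n) e = 0" "hcoeff (w m) (x m) \<noteq> 0"
        "\<And>n. n \<noteq> m \<Longrightarrow> n \<noteq> j \<Longrightarrow> n \<noteq> k \<Longrightarrow> w n = 0"
        by (rule circuit_exists[OF br tie, of m]) (use Suc.prems in auto)
      \<comment> \<open>The multiple of \<open>w\<close> that cancels the coefficient of
        \<open>z n\<close> at \<open>x n\<close>. If the divisor is 0, the value is 0 and no
        cancellation can occur.\<close>
      define r where "r n = - hcoeff (z n) (x n) / hcoeff (w n) (x n)" for n
      obtain c where c: "c \<noteq> 0" "c \<noteq> r j" "c \<noteq> r k" using avoid_three[OF F] .
      define u where "u n = z n + hmonom 0 c * w n" for n
      have cu: "hcoeff (u n) e = hcoeff (z n) e + c * hcoeff (w n) e" for n e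
        by (simp add: u_def hcoeff_hmonom_times)
      have "hcoeff (u n) (x n) \<noteq> 0" if n: "n < Suc m" for n
      proof (cases "n = m")
        case True
        then show ?thesis using c w(3) \<open>hcoeff (z m) (x m) = 0\<close> by (simp add: cu)
      next
        case False
        then have zn: "hcoeff (z n) (x n) \<noteq> 0" using n z(3) by auto
        show ?thesis
        proof (cases "hcoeff (w n) (x n) = 0")
          case True
          then show ?thesis using zn by (simp add: cu)
        next
          case False
          then have "n = j \<or> n = k" using w(4) \<open>n \<noteq> m\<close> by (metis hcoeff_zero)
          then have "c \<noteq> r n" using c by auto
          then show ?thesis using False by (auto simp: cu r_def field_simps add_eq_0_iff)
        qed
      qed
      moreover have "in_kernel u" unfolding u_def using in_kernel_add_mult z(1) w(1) by blast
      moreover have "hcoeff (u n) e = 0" if "e < x n" for n e using z(2) w(2) that by (simp add: cu)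
      ultimately show ?thesis by blast
    qed
  qed
  from this[of 5] obtain z where z: "in_kernel z" "\<And>n e. e < x n \<Longrightarrow> hcoeff (z n) e = 0" "\<And>n. n < 5 \<Longrightarrow> hcoeff (z n) (x n) \<noteq> 0"
    by auto
  show thesis by (rule that[of z]) (use z hdeg_eqI[of "z _" "x _"] in blast)+
qed

text \<open>Cramer's rule expresses the last two rows by the first three.\<close>

lemma kernel_rank:
  assumes A: "A \<in> carrier_mat 5 n" and br: "bracket 3 4 \<noteq> 0"
    and ker: "\<And>j. j < n \<Longrightarrow> in_kernel (\<lambda>i. A $$ (i, j))"
  shows "vec_space.rank 5 A \<le> 3"
proof -
  define U where "U m i = (if i < 3 then if i = m then 1 else 0 else if i = 3 then - bracket m 4 / bracket 3 4 else bracket m 3 / bracket 3 4)" for m i :: nat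
  define R where "R m = Matrix.mat 5 n (\<lambda>(i, j). U m i * A $$ (m, j))" for m
  interpret vec_space "TYPE('f hahn)" 5 .
  have Rc: "R m \<in> carrier_mat 5 n" for m by (simp add: R_def)
  have R: "rank (R m) \<le> 1" for m
    by (rule rank_le_1_product_entries[OF Rc, of _ "U m" "\<lambda>j. A $$ (m, j)"]) (simp add: R_def)
  have "A = R 0 + R 1 + R 2"
  proof (rule eq_matI)
    fix i j assume "i < dim_row (R 0 + R 1 + R 2)" "j < dim_col (R 0 + R 1 + R 2)"
    then have ij: "i < 5" "j < n" by (auto simp: R_def)
    let ?a = "\<lambda>i. A $$ (i, j)"
    have k: "?a 0 * y1 0 + ?a 1 * y1 1 + ?a 2 * y1 2 + ?a 3 * y1 3 + ?a 4 * y1 4 = 0"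
       "?a 0 * y2 0 + ?a 1 * y2 1 + ?a 2 * y2 2 + ?a 3 * y2 3 + ?a 4 * y2 4 = 0"
      using ker[OF ij(2)] by (simp_all add: in_kernel_def eval_nat_numeral add.assoc)
    have "?a 3 * bracket 3 4 + (?a 0 * bracket 0 4 + ?a 1 * bracket 1 4 + ?a 2 * bracket 2 4)
        = (?a 0 * y1 0 + ?a 1 * y1 1 + ?a 2 * y1 2 + ?a 3 * y1 3 + ?a 4 * y1 4) * y2 4
        - (?a 0 * y2 0 + ?a 1 * y2 1 + ?a 2 * y2 2 + ?a 3 * y2 3 + ?a 4 * y2 4) * y1 4"
      unfolding bracket_def by (simp add: algebra_simps)
    then have "?a 3 * bracket 3 4 = - (?a 0 * bracket 0 4 + ?a 1 * bracket 1 4 + ?a 2 * bracket 2 4)"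
      unfolding k by (simp only: mult_zero_left diff_0_right eq_neg_iff_add_eq_0)
    then have "?a 3 = - (?a 0 * bracket 0 4 + ?a 1 * bracket 1 4 + ?a 2 * bracket 2 4) / bracket 3 4"
      using br by (metis nonzero_mult_div_cancel_right)
    then have 3: "?a 3 = - bracket 0 4 / bracket 3 4 * ?a 0 + - bracket 1 4 / bracket 3 4 * ?a 1 + - bracket 2 4 / bracket 3 4 * ?a 2"
      by (simp add: add_divide_distrib diff_divide_distrib mult.commute)
    have "?a 4 * bracket 3 4 - (?a 0 * bracket 0 3 + ?a 1 * bracket 1 3 + ?a 2 * bracket 2 3)
        = (?a 0 * y2 0 + ?a 1 * y2 1 + ?a 2 * y2 2 + ?a 3 * y2 3 + ?a 4 * y2 4) * y1 3
        - (?a 0 * y1 0 + ?a 1 * y1 1 + ?a 2 * y1 2 + ?a 3 * y1 3 + ?a 4 * y1 4) * y2 3"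
      unfolding bracket_def by (simp add: algebra_simps)
    then have "?a 4 * bracket 3 4 = ?a 0 * bracket 0 3 + ?a 1 * bracket 1 3 + ?a 2 * bracket 2 3"
      unfolding k by simp
    then have "?a 4 = (?a 0 * bracket 0 3 + ?a 1 * bracket 1 3 + ?a 2 * bracket 2 3) / bracket 3 4"
      using br by (metis nonzero_mult_div_cancel_right)
    then have 4: "?a 4 = bracket 0 3 / bracket 3 4 * ?a 0 + bracket 1 3 / bracket 3 4 * ?a 1 + bracket 2 3 / bracket 3 4 * ?a 2"
      by (simp add: add_divide_distrib mult.commute)
    have "i = 0 \<or> i = 1 \<or> i = 2 \<or> i = 3 \<or> i = 4" using ij(1) by auto
    then show "A $$ (i, j) = (R 0 + R 1 + R 2) $$ (i, j)"
      using ij 3 4 by (auto simp: R_def U_def)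
  qed (use A in \<open>auto simp: R_def\<close>)
  then have "rank A \<le> rank (R 0 + R 1) + rank (R 2)"
    using rank_subadditive[of "R 0 + R 1" n "R 2"] Rc by auto
  also have "rank (R 0 + R 1) \<le> rank (R 0) + rank (R 1)"
    using rank_subadditive Rc by blast
  finally show ?thesis using R[of 0] R[of 1] R[of 2] by simp
qed
end

section \<open>Tropical rank\<close>

text \<open>Adding \<open>w\<close> to the rows changes all weights by the same amount. Afterwards
  every column has its strict minimum at the entry chosen by \<open>\<tau>\<close>, so every other
  permutation weighs more.\<close>

lemma trop_nonsingularI:
  assumes B: "B \<in> carrier_mat r r" and \<tau>: "\<tau> permutes {..<r}"
    and less: "\<And>i k. i < r \<Longrightarrow> k < r \<Longrightarrow> k \<noteq> i \<Longrightarrow> w i + B $$ (i, \<tau> i) < w k + B $$ (k, \<tau> i)"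
  shows "trop_nonsingular B"
proof -
  have dim: "dim_row B = r" using B by simp
  have lt: "trop_weight B \<tau> < trop_weight B \<sigma>" if \<sigma>: "\<sigma> permutes {..<r}" and ne: "\<sigma> \<noteq> \<tau>" for \<sigma>
  proof -
    define q where "q = inv_into UNIV \<sigma> \<circ> \<tau>"
    have q: "q permutes {..<r}" unfolding q_def by (intro permutes_compose permutes_inv \<sigma> \<tau>)
    have \<sigma>q: "\<sigma> (q i) = \<tau> i" for i unfolding q_def by (simp add: permutes_inverses[OF \<sigma>])
    have "q \<noteq> id" using ne \<sigma>q by (metis eq_id_iff ext)
    then obtain i where qi: "q i \<noteq> i" by (auto simp: fun_eq_iff)
    then have i: "i < r" "q i \<noteq> i" using permutes_not_in[OF q, of i] by auto
    have in_r: "q i < r" if "i < r" for i using permutes_in_image[OF q, of i] that by simp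
    have "(\<Sum>i<r. w i + B $$ (i, \<tau> i)) < (\<Sum>i<r. w (q i) + B $$ (q i, \<tau> i))"
    proof (rule sum_strict_mono_ex1)
      show "\<forall>i\<in>{..<r}. w i + B $$ (i, \<tau> i) \<le> w (q i) + B $$ (q i, \<tau> i)"
      proof
        fix i assume "i \<in> {..<r}"
        then show "w i + B $$ (i, \<tau> i) \<le> w (q i) + B $$ (q i, \<tau> i)"
          using less[of i "q i"] in_r[of i] by (cases "q i = i") auto
      qed
      show "\<exists>i\<in>{..<r}. w i + B $$ (i, \<tau> i) < w (q i) + B $$ (q i, \<tau> i)"
        using less[of i "q i"] in_r[of i] i by auto
    qed simp
    also have "\<dots> = (\<Sum>i<r. w i + B $$ (i, \<sigma> i))"
      using sum.permute[OF q, of "\<lambda>i. w i + B $$ (i, \<sigma> i)"] by (simp add: o_def \<sigma>q)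
    finally show ?thesis by (simp add: sum.distrib trop_weight_def dim)
  qed
  have fin: "finite {\<tau>. \<tau> permutes {..<r}}" by (simp add: finite_permutations)
  have min: "(MIN \<sigma>\<in>{\<sigma>. \<sigma> permutes {..<r}}. trop_weight B \<sigma>) = trop_weight B \<tau>"
  proof (rule Min_eqI)
    fix y assume "y \<in> trop_weight B ` {\<sigma>. \<sigma> permutes {..<r}}"
    then obtain \<sigma> where "\<sigma> permutes {..<r}" "y = trop_weight B \<sigma>" by blast
    then show "trop_weight B \<tau> \<le> y" using lt[of \<sigma>] by (cases "\<sigma> = \<tau>") auto
  qed (use fin \<tau> in auto)
  have "\<exists>!\<sigma>. \<sigma> permutes {..<r} \<and> trop_weight B \<sigma> = trop_weight B \<tau>"
  proof (rule ex1I[of _ \<tau>])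
    fix \<sigma> assume "\<sigma> permutes {..<r} \<and> trop_weight B \<sigma> = trop_weight B \<tau>"
    then show "\<sigma> = \<tau>" using lt[of \<sigma>] by auto
  qed (simp add: \<tau>)
  then show ?thesis using B unfolding trop_nonsingular_def dim min by simp
qed

text \<open>The inequalities force \<open>\<kappa>\<close> to be injective on \<open>I\<close>;
  renumbering by \<open>pick\<close> then reduces the claim to
  \<open>trop_nonsingularI\<close>.\<close>

lemma trop_rank_ge:
  assumes I: "I \<subseteq> {..<dim_row M}" and \<kappa>: "\<kappa> ` I \<subseteq> {..<dim_col M}"
    and less: "\<And>i k. i \<in> I \<Longrightarrow> k \<in> I \<Longrightarrow> k \<noteq> i \<Longrightarrow> w i + M $$ (i, \<kappa> i) < w k + M $$ (k, \<kappa> i)"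
  shows "card I \<le> trop_rank M"
proof -
  define J where "J = \<kappa> ` I"
  define r where "r = card I"
  define B where "B = submatrix M I J"
  have finI: "finite I" using I finite_subset by blast
  have inj: "inj_on \<kappa> I"
  proof (rule inj_onI, rule ccontr)
    fix i k assume "i \<in> I" "k \<in> I" "\<kappa> i = \<kappa> k" "i \<noteq> k"
    then show False using less[of i k] less[of k i] by auto
  qed
  have cJ: "card J = r" by (simp add: J_def r_def card_image[OF inj])
  have sets: "{i. i < dim_row M \<and> i \<in> I} = I" "{j. j < dim_col M \<and> j \<in> J} = J"
    using I \<kappa> by (auto simp: J_def)
  have B: "B \<in> carrier_mat r r" unfolding B_def by (intro carrier_matI) (simp_all add: dim_submatrix sets r_def cJ)
  have Bij: "B $$ (s, t) = M $$ (pick I s, pick J t)" if "s < r" "t < r" for s t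
    unfolding B_def using that by (intro submatrix_index) (simp_all add: sets r_def cJ)
  have pickI: "pick I s \<in> I" if "s < r" for s using that pick_in_set_le[of s I] by (simp add: r_def)
  \<comment> \<open>The position of the chosen column in the increasing enumeration of
    \<open>J\<close>.\<close>
  define \<tau> where "\<tau> s = (if s < r then card {a \<in> J. a < \<kappa> (pick I s)} else s)" for s
  have \<tau>: "\<tau> s < r \<and> pick J (\<tau> s) = \<kappa> (pick I s)" if s: "s < r" for s
  proof -
    have k: "\<kappa> (pick I s) \<in> J" using pickI[OF s] by (simp add: J_def)
    have "{a \<in> J. a < \<kappa> (pick I s)} \<subset> J" using k by auto
    then have "card {a \<in> J. a < \<kappa> (pick I s)} < card J" by (intro psubset_card_mono) (auto simp: J_def finI)
    then show ?thesis using s pick_card_in_set[OF k] by (simp add: \<tau>_def cJ)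
  qed
  have pinj: "s = t" if "s < r" "t < r" "pick I s = pick I t" for s t
  proof -
    have "s = card {a \<in> I. a < pick I s}" "t = card {a \<in> I. a < pick I t}"
      using that(1,2) by (simp_all only: card_pick_le r_def)
    then show ?thesis by (simp only: that(3))
  qed
  have "inj_on \<tau> {..<r}"
  proof (rule inj_onI)
    fix s t assume st: "s \<in> {..<r}" "t \<in> {..<r}" "\<tau> s = \<tau> t"
    then have "\<kappa> (pick I s) = \<kappa> (pick I t)" using \<tau>[of s] \<tau>[of t] by simp
    then have "pick I s = pick I t" using inj_onD[OF inj] pickI st by simp
    then show "s = t" using pinj st by simp
  qed
  moreover have "\<tau> ` {..<r} \<subseteq> {..<r}" using \<tau> by auto
  ultimately have "bij_betw \<tau> {..<r} {..<r}" by (simp add: bij_betw_def endo_inj_surj)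
  then have perm: "\<tau> permutes {..<r}" by (rule bij_imp_permutes) (simp add: \<tau>_def)
  have "trop_nonsingular B"
  proof (rule trop_nonsingularI[OF B perm, of "\<lambda>s. w (pick I s)"])
    fix s t assume st: "s < r" "t < r" "t \<noteq> s"
    then have "pick I t \<noteq> pick I s" using pinj by blast
    then show "w (pick I s) + B $$ (s, \<tau> s) < w (pick I t) + B $$ (t, \<tau> s)"
      using less[of "pick I s" "pick I t"] pickI \<tau>[of s] st by (simp add: Bij)
  qed
  then have mem: "r \<in> {r. \<exists>I J. I \<subseteq> {..<dim_row M} \<and> J \<subseteq> {..<dim_col M} \<and>
     card I = r \<and> card J = r \<and> trop_nonsingular (submatrix M I J)}"
    by (intro CollectI exI[of _ I] exI[of _ J] conjI) (use I \<kappa> cJ in \<open>simp_all add: r_def B_def J_def\<close>)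
  have "finite {r. \<exists>I J. I \<subseteq> {..<dim_row M} \<and> J \<subseteq> {..<dim_col M} \<and>
     card I = r \<and> card J = r \<and> trop_nonsingular (submatrix M I J)}"
  proof (rule finite_subset)
    show "{r. \<exists>I J. I \<subseteq> {..<dim_row M} \<and> J \<subseteq> {..<dim_col M} \<and>
     card I = r \<and> card J = r \<and> trop_nonsingular (submatrix M I J)} \<subseteq> card ` Pow {..<dim_row M}" by blast
  qed auto
  then show ?thesis unfolding trop_rank_def r_def[symmetric] using mem by (rule Max_ge)
qed

section \<open>Realising tropical planes and lifting their points\<close>

text \<open>Five points on the projective line over the Hahn series: \<open>m\<close> at infinity,
  \<open>a\<close> at 0, \<open>k\<close> at 1, \<open>b\<close> and \<open>l\<close> at distances
  of degree \<open>A\<close> from \<open>a\<close> and \<open>B\<close> from \<open>k\<close>. The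
  brackets are their differences.\<close>

lemma plane_realize:
  assumes F: "infinite (UNIV :: 'f::field set) \<or> card (UNIV :: 'f set) \<ge> 4"
    and f: "five a b m k l" and A: "0 \<le> A" and B: "0 \<le> B"
  obtains y1 y2 :: "nat \<Rightarrow> 'f::field hahn" where "\<forall>i<5. \<forall>j<5. i \<noteq> j \<longrightarrow> bracket y1 y2 i j \<noteq> 0"
    "\<And>i j. {i, j} = {a, b} \<Longrightarrow> hdeg (bracket y1 y2 i j) = A"
    "\<And>i j. {i, j} = {k, l} \<Longrightarrow> hdeg (bracket y1 y2 i j) = B"
    "\<And>i j. i < 5 \<Longrightarrow> j < 5 \<Longrightarrow> i \<noteq> j \<Longrightarrow> {i, j} \<noteq> {a, b} \<Longrightarrow> {i, j} \<noteq> {k, l} \<Longrightarrow> hdeg (bracket y1 y2 i j) = 0"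
proof -
  \<comment> \<open>The residues 0, 1, \<open>r\<close> and \<open>t = 1 + s\<close> are distinct,
    which keeps the other brackets of degree 0 even if \<open>A\<close> or \<open>B\<close> is 0.
    This takes four elements of the field.\<close>
  obtain r :: 'f where r: "r \<noteq> 0" "r \<noteq> 1" using avoid_three[OF F] by metis
  obtain t :: 'f where t: "t \<noteq> 0" "t \<noteq> 1" "t \<noteq> r" using avoid_three[OF F] by metis
  define s where "s = t - 1"
  have s: "s \<noteq> 0" "1 + s \<noteq> 0" "1 + s \<noteq> r" using t by (auto simp: s_def)
  define y1 where "y1 i = (if i = m then 0 else 1 :: 'f hahn)" for i
  define y2 where "y2 i = (if i = a then 0 else if i = b then hmonom A r else if i = l then 1 + hmonom B s else 1)" for i
  have d: "distinct [a, b, m, k, l]" by (rule five_distinct[OF f])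
  let ?g = "\<lambda>i j e. bracket y1 y2 i j \<noteq> 0 \<and> hdeg (bracket y1 y2 i j) = e"
  have swap: "?g j i e" if "?g i j e" for i j e
  proof -
    have "bracket y1 y2 j i = - bracket y1 y2 i j" by (rule bracket_commute)
    then show ?thesis using that by (simp add: hdeg_uminus)
  qed
  have g: "?g i j e" if "hcoeff (bracket y1 y2 i j) e \<noteq> 0" "\<And>e'. e' < e \<Longrightarrow> hcoeff (bracket y1 y2 i j) e' = 0" for i j e
    using hdeg_eqI[OF that] by blast
  have *: "?g a b A" "?g k l B" "?g a k 0" "?g a l 0" "?g b k 0" "?g b l 0" "?g a m 0" "?g b m 0" "?g k m 0" "?g l m 0"
    by (intro g; use d A B r s in \<open>auto simp: bracket_def y1_def y2_def hcoeff_one hcoeff_hmonom\<close>)+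
  have R: "i \<in> {a, b, m, k, l}" if "i < 5" for i using f that unfolding five_def by auto
  have all: "?g i j (if {i, j} = {a, b} then A else if {i, j} = {k, l} then B else 0)"
    if ij: "i < 5" "j < 5" "i \<noteq> j" for i j
    using R[OF ij(1)] R[OF ij(2)] ij(3) d * *[THEN swap] by (auto simp: doubleton_eq_iff)
  have lt: "a < 5" "b < 5" "k < 5" "l < 5" using five_less[OF f] by auto
  show thesis
  proof (rule that)
    show "\<forall>i<5. \<forall>j<5. i \<noteq> j \<longrightarrow> bracket y1 y2 i j \<noteq> 0" using all by blast
    show "hdeg (bracket y1 y2 i j) = A" if "{i, j} = {a, b}" for i j
      using that * *[THEN swap] by (auto simp: doubleton_eq_iff)
    show "hdeg (bracket y1 y2 i j) = B" if "{i, j} = {k, l}" for i j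
      using that * *[THEN swap] by (auto simp: doubleton_eq_iff)
    show "hdeg (bracket y1 y2 i j) = 0" if "i < 5" "j < 5" "i \<noteq> j" "{i, j} \<noteq> {a, b}" "{i, j} \<noteq> {k, l}" for i j
      using all[OF that(1-3)] that(4,5) by simp
  qed
qed

lemma ties_removeD:
  assumes f: "five q b c d e" and t: "tie4 (h b) (h c) (h d) (h e)" and i: "i < 5" "i \<noteq> q"
  shows "\<exists>j<5. j \<noteq> i \<and> j \<noteq> q \<and> h j \<le> h i"
proof -
  have "ties ({..<5} - {q}) h"
    unfolding five_remove[OF f] using ties_tie4[of b c d e h] five_distinct[OF f] t by auto
  then show ?thesis using i unfolding ties_def by blast
qed

lemma coplanar_lift:
  assumes F: "infinite (UNIV :: 'f::field set) \<or> card (UNIV :: 'f set) \<ge> 4"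
    and C: "coplanar C"
  obtains y1 y2 :: "nat \<Rightarrow> 'f::field hahn" where "bracket y1 y2 3 4 \<noteq> 0"
    "\<And>v. v \<in> C \<Longrightarrow> \<exists>z. in_kernel y1 y2 z \<and> (\<forall>i<5. z i \<noteq> 0 \<and> hdeg (z i) = v i)"
proof -
  obtain a b m k l A B p where f: "five a b m k l" and AB: "0 \<le> A" "0 \<le> B"
    and pl: "\<And>v. v \<in> C \<Longrightarrow> plane A B (p a + v a) (p b + v b) (p m + v m) (p k + v k) (p l + v l)"
    using C unfolding coplanar_def by blast
  obtain y1 y2 :: "nat \<Rightarrow> 'f hahn" where y: "\<forall>i<5. \<forall>j<5. i \<noteq> j \<longrightarrow> bracket y1 y2 i j \<noteq> 0"
    "\<And>i j. {i, j} = {a, b} \<Longrightarrow> hdeg (bracket y1 y2 i j) = A"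
    "\<And>i j. {i, j} = {k, l} \<Longrightarrow> hdeg (bracket y1 y2 i j) = B"
    "\<And>i j. i < 5 \<Longrightarrow> j < 5 \<Longrightarrow> i \<noteq> j \<Longrightarrow> {i, j} \<noteq> {a, b} \<Longrightarrow> {i, j} \<noteq> {k, l} \<Longrightarrow> hdeg (bracket y1 y2 i j) = 0"
    by (rule plane_realize[OF F f AB]) blast
  \<comment> \<open>Scaling the coordinates by monomials undoes the translation by
    \<open>p\<close>.\<close>
  define c where "c i = hmonom (p i) (1 :: 'f)" for i
  define c' where "c' i = hmonom (- p i) (1 :: 'f)" for i
  have c'c: "c' i * c i = 1" for i
    by (rule hahn_eqI) (simp add: c'_def c_def hcoeff_hmonom_times hcoeff_hmonom hcoeff_one)
  have c0: "c i \<noteq> 0" "c' i \<noteq> 0" for i using c'c[of i] by auto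
  define x1 where "x1 i = c i * y1 i" for i
  define x2 where "x2 i = c i * y2 i" for i
  have brx: "bracket x1 x2 i j = c i * c j * bracket y1 y2 i j" for i j
    by (simp add: bracket_def x1_def x2_def algebra_simps)
  have d: "distinct [a, b, m, k, l]" by (rule five_distinct[OF f])
  have lt: "a < 5" "b < 5" "m < 5" "k < 5" "l < 5" using five_less[OF f] by auto
  have fs: "five b a m k l" "five m a b k l" "five k a b m l" "five l a b m k" using f by (simp_all add: five_def insert_commute)
  show thesis
  proof (rule that)
    show "bracket x1 x2 3 4 \<noteq> 0" using y(1) c0 by (simp add: brx)
    fix v assume v: "v \<in> C"
    define x where "x i = p i + v i" for i
    have P: "tie4 (x a) (x b) (x k) (x l)" "tie4 (A + x b) (x k) (x l) (x m)" "tie4 (A + x a) (x k) (x l) (x m)"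
      "tie4 (B + x l) (x a) (x b) (x m)" "tie4 (B + x k) (x a) (x b) (x m)"
      using pl[OF v] unfolding plane_def x_def by blast+
    have D0: "hdeg (bracket y1 y2 i j) = 0" if "(i, j) \<in> {a, b} \<times> {k, l, m} \<union> {k, l, m} \<times> {a, b} \<union> {k, l} \<times> {m} \<union> {m} \<times> {k, l}" for i j
      using that d lt by (intro y(4)) (auto simp: doubleton_eq_iff)
    have DA: "hdeg (bracket y1 y2 a b) = A" "hdeg (bracket y1 y2 b a) = A" using y(2) by auto
    have DB: "hdeg (bracket y1 y2 k l) = B" "hdeg (bracket y1 y2 l k) = B" using y(3) by auto
    \<comment> \<open>The condition for \<open>q\<close> is the circuit of \<open>plane\<close> that
      omits row \<open>q\<close>.\<close>
    have tie: "\<forall>q<5. \<forall>i<5. i \<noteq> q \<longrightarrow> (\<exists>j<5. j \<noteq> i \<and> j \<noteq> q \<and> hdeg (bracket y1 y2 j q) + x j \<le> hdeg (bracket y1 y2 i q) + x i)"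
    proof (intro allI impI)
      fix q i :: nat assume q: "q < 5" and i: "i < 5" "i \<noteq> q"
      let ?h = "\<lambda>j. hdeg (bracket y1 y2 j q) + x j"
      have "q \<in> {a, b, m, k, l}" using f q unfolding five_def by auto
      then consider "q = a" | "q = b" | "q = m" | "q = k" | "q = l" by blast
      then show "\<exists>j<5. j \<noteq> i \<and> j \<noteq> q \<and> ?h j \<le> ?h i"
      proof cases
        case 1
        then have "tie4 (?h b) (?h m) (?h k) (?h l)" using P(2) by (simp add: D0 DA tie4_def) argo
        then show ?thesis using ties_removeD[of q b m k l ?h i] f i 1 by simp
      next
        case 2
        then have "tie4 (?h a) (?h m) (?h k) (?h l)" using P(3) by (simp add: D0 DA tie4_def) argo
        then show ?thesis using ties_removeD[of q a m k l ?h i] fs i 2 by simp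
      next
        case 3
        then have "tie4 (?h a) (?h b) (?h k) (?h l)" using P(1) by (simp add: D0 tie4_def)
        then show ?thesis using ties_removeD[of q a b k l ?h i] fs i 3 by simp
      next
        case 4
        then have "tie4 (?h a) (?h b) (?h m) (?h l)" using P(4) by (simp add: D0 DB tie4_def) argo
        then show ?thesis using ties_removeD[of q a b m l ?h i] fs i 4 by simp
      next
        case 5
        then have "tie4 (?h a) (?h b) (?h m) (?h k)" using P(5) by (simp add: D0 DB tie4_def) argo
        then show ?thesis using ties_removeD[of q a b m k ?h i] fs i 5 by simp
      qed
    qed
    obtain z where z: "in_kernel y1 y2 z" "\<And>i. i < 5 \<Longrightarrow> z i \<noteq> 0" "\<And>i. i < 5 \<Longrightarrow> hdeg (z i) = x i"
      by (rule kernel_lift[OF F y(1) tie]) blast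
    have "c' i * z i \<noteq> 0 \<and> hdeg (c' i * z i) = v i" if i: "i < 5" for i
    proof -
      have co: "hcoeff (c' i * z i) e = hcoeff (z i) (e + p i)" for e
        by (simp add: c'_def hcoeff_hmonom_times)
      have xv: "v i + p i = hdeg (z i)" using z(3)[OF i] by (simp add: x_def)
      show ?thesis using hdeg_eqI[of "c' i * z i" "v i"] hcoeff_hdeg[OF z(2)[OF i]] hcoeff_less_hdeg[OF z(2)[OF i]] xv
        by (simp add: co)
    qed
    moreover have "(c' i * z i) * (c i * y) = z i * y" for i y
      using c'c[of i] by (metis (no_types, lifting) mult.assoc mult.left_commute mult.right_neutral)
    then have "in_kernel x1 x2 (\<lambda>i. c' i * z i)"
      using z(1) unfolding in_kernel_def x1_def x2_def by (simp only:)
    ultimately show "\<exists>z. in_kernel x1 x2 z \<and> (\<forall>i<5. z i \<noteq> 0 \<and> hdeg (z i) = v i)" by blast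
  qed
qed

section \<open>From tropical rank to Kapranov rank\<close>

text \<open>For four untied rows, \<open>tie4_alternative\<close> provides a column for each row in
  which it is the strict minimum, and \<open>trop_rank_ge\<close> turns these into tropical rank at
  least 4.\<close>

lemma trop_rank_quads_dep:
  assumes C: "C \<in> carrier_mat 5 n" and r: "trop_rank C \<le> 3"
  shows "quads_dep ((\<lambda>j i. C $$ (i, j)) ` {..<n})"
    (is "quads_dep ?C")
proof -
  have "\<exists>x. dep ?C a x" if a: "a < 5" for a
  proof -
    have "card ({..<5} - {a}) = 4" using a by simp
    then obtain b k l m where s: "{..<5} - {a} = {b, k, l, m}"
      by (auto simp: card_Suc_eq numeral_eq_Suc)
    have f: "five a b k l m" using s a unfolding five_def by auto
    have d: "distinct [a, b, k, l, m]" by (rule five_distinct[OF f])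
    show ?thesis
    proof (rule tie4_alternative[of "{..<n}" "\<lambda>j. C $$ (b, j)" "\<lambda>j. C $$ (k, j)" "\<lambda>j. C $$ (l, j)" "\<lambda>j. C $$ (m, j)"])
      fix x y z
      assume t: "\<And>j. j \<in> {..<n} \<Longrightarrow> tie4 (x + C $$ (b, j)) (y + C $$ (k, j)) (z + C $$ (l, j)) (C $$ (m, j))"
      define w where "w = (\<lambda>_. 0::real)(b := x, k := y, l := z)"
      have "w b = x" "w k = y" "w l = z" "w m = 0" using d by (auto simp: w_def)
      then have "dep ?C a w" unfolding dep_iff[OF f] using t by auto
      then show ?thesis by blast
    next
      fix x y z j1 j2 j3 j4
      assume j: "j1 \<in> {..<n}" "j2 \<in> {..<n}" "j3 \<in> {..<n}" "j4 \<in> {..<n}"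
        and lt: "x + C $$ (b, j1) < y + C $$ (k, j1)" "x + C $$ (b, j1) < z + C $$ (l, j1)" "x + C $$ (b, j1) < C $$ (m, j1)"
        "y + C $$ (k, j2) < x + C $$ (b, j2)" "y + C $$ (k, j2) < z + C $$ (l, j2)" "y + C $$ (k, j2) < C $$ (m, j2)"
        "z + C $$ (l, j3) < x + C $$ (b, j3)" "z + C $$ (l, j3) < y + C $$ (k, j3)" "z + C $$ (l, j3) < C $$ (m, j3)"
        "C $$ (m, j4) < x + C $$ (b, j4)" "C $$ (m, j4) < y + C $$ (k, j4)" "C $$ (m, j4) < z + C $$ (l, j4)"
      define w where "w = (\<lambda>_. 0::real)(b := x, k := y, l := z)"
      define \<kappa> where "\<kappa> = (\<lambda>_. j4)(b := j1, k := j2, l := j3)"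
      have w: "w b = x" "w k = y" "w l = z" "w m = 0" and \<kappa>: "\<kappa> b = j1" "\<kappa> k = j2" "\<kappa> l = j3" "\<kappa> m = j4"
        using d by (auto simp: w_def \<kappa>_def)
      have "card {b, k, l, m} \<le> trop_rank C"
      proof (rule trop_rank_ge[where \<kappa> = \<kappa> and w = w])
        show "{b, k, l, m} \<subseteq> {..<dim_row C}" using C five_less[OF f] by auto
        show "\<kappa> ` {b, k, l, m} \<subseteq> {..<dim_col C}" using C j by (auto simp: \<kappa>)
        fix i q assume "i \<in> {b, k, l, m}" "q \<in> {b, k, l, m}" "q \<noteq> i"
        then show "w i + C $$ (i, \<kappa> i) < w q + C $$ (q, \<kappa> i)"
          using lt by (elim insertE emptyE) (simp_all add: w \<kappa>)
      qed
      then show ?thesis using r d by simp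
    qed simp
  qed
  then show ?thesis by (simp add: quads_dep_def)
qed

theorem theorem10:
  fixes C :: "real mat" and n :: nat
  assumes "infinite (UNIV :: 'f::field set) \<or> card (UNIV :: 'f set) \<ge> 4"
    and "C \<in> carrier_mat 5 n"
    and "trop_rank C \<le> 3"
  shows "kapranov_rank TYPE('f) C \<le> 3"
proof -
  let ?C = "(\<lambda>j i. C $$ (i, j)) ` {..<n}"
  have "coplanar ?C" by (rule quads_dep_coplanar[OF trop_rank_quads_dep[OF assms(2,3)]])
  then obtain y1 y2 :: "nat \<Rightarrow> 'f hahn" where y: "bracket y1 y2 3 4 \<noteq> 0"
    "\<And>v. v \<in> ?C \<Longrightarrow> \<exists>z. in_kernel y1 y2 z \<and> (\<forall>i<5. z i \<noteq> 0 \<and> hdeg (z i) = v i)"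
    by (rule coplanar_lift[OF assms(1)]) blast
  have "\<forall>j. \<exists>z. j < n \<longrightarrow> in_kernel y1 y2 z \<and> (\<forall>i<5. z i \<noteq> 0 \<and> hdeg (z i) = C $$ (i, j))"
    using y(2) by blast
  then obtain Z where Z: "\<And>j. j < n \<Longrightarrow> in_kernel y1 y2 (Z j)"
    "\<And>i j. j < n \<Longrightarrow> i < 5 \<Longrightarrow> Z j i \<noteq> 0 \<and> hdeg (Z j i) = C $$ (i, j)"
    by metis
  define A where "A = Matrix.mat 5 n (\<lambda>(i, j). Z j i)"
  have A: "A \<in> carrier_mat 5 n" by (simp add: A_def)
  have dim: "dim_row C = 5" "dim_col C = n" using assms(2) by auto
  have "A \<in> hahn_lifts C"
    unfolding hahn_lifts_def dim using Z(2) dim by (auto simp: A_def)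
  then have "kapranov_rank TYPE('f) C \<le> vec_space.rank 5 A"
    unfolding kapranov_rank_def dim by (intro Least_le) blast
  also have "\<dots> \<le> 3"
  proof (rule kernel_rank[OF A y(1)])
    fix j assume j: "j < n"
    have "in_kernel y1 y2 (\<lambda>i. A $$ (i, j)) = in_kernel y1 y2 (Z j)"
      unfolding in_kernel_def using j by (simp add: A_def)
    then show "in_kernel y1 y2 (\<lambda>i. A $$ (i, j))" using Z(1)[OF j] by simp
  qed
  finally show ?thesis .
qed

end
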